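(* Let $\mathbf{Phys}$ and $\ast\mathbf{Mod}$ be as in the context. The assignments $(A,\varphi)\mapsto (A, GNS(\varphi))$ on objects, and, for a morphism $f:(A,\varphi)\to(B,\psi)$ of $\mathbf{Phys}$ (a $\ast$-homomorphism $f:B\to A$), $$GNS(f) : GNS(\psi)=B/B^\perp \to GNS(\varphi)=A/A^\perp,\qquad [x]\mapsto [f(x)],$$ are well defined, with $(f, GNS(f))$ a morphism $(B,GNS(\psi))\to(A,GNS(\varphi))$ of $\ast\mathbf{Mod}$, and they form a strong symmetric monoidal contravariant functor $GNS:\mathbf{Phys}^{op}\to\ast\mathbf{Mod}$ lying over the functor $(A,\varphi)\mapsto A$; in particular $GNS(\varphi\otimes\psi)\cong GNS(\varphi)\otimes GNS(\psi)$ via $[a\otimes b]\mapsto [a]\otimes[b]$.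
   Context: $\ast$-algebras: unital complex algebras with conjugate-linear involutive anti-homomorphism $\ast$; $\ast$-homomorphisms unital and $\ast$-preserving. Hermitian forms linear in the first variable, possibly indefinite. A $\ast$-module over $A$: vector space with nondegenerate Hermitian form and unital left $A$-module structure with $\langle am,n\rangle=\langle m,a^\ast n\rangle$. A representable state on $A$ is a linear $\varphi:A\to\mathbb{C}$ with $\varphi(a^\ast)=\overline{\varphi(a)}$; $A^\perp$ is the radical of $\langle a,b\rangle_\varphi=\varphi(b^\ast a)$ and $GNS(\varphi)=A/A^\perp$ with induced form and left multiplication. A $\ast$-homomorphism $f:B\to A$ is admissible for a representable state $\varphi$ on $A$ if $B^\perp\subseteq f^{-1}(A^\perp)$, with $B^\perp$ computed for $\varphi\circ f$. $\mathbf{Phys}$: objects are pairs $(A,\varphi)$, $\varphi$ a representable state on $A$; morphisms $(A,\varphi)\to(B,\psi)$ are $\ast$-homomorphisms $f:B\to A$ with $\varphi\circ f=\psi$ that are admissible for $\varphi$; composition is composition of homomorphisms; monoidal product $(A,\varphi)\otimes(B,\psi)=(A\otimes B,\varphi\otimes\psi)$, unit $(\mathbb{C},\mathrm{id})$. $\ast\mathbf{Mod}$: objects pairs $(A,M)$ with $M$ a $\ast$-module over $A$; morphisms $(A,M)\to(B,N)$ are pairs $(f,h)$ with $f:A\to B$ a $\ast$-homomorphism and $h:M\to N$ a linear isometry ($\langle hx,hy\rangle=\langle x,y\rangle$) with $h(am)=f(a)h(m)$; monoidal product $(A,M)\otimes(B,N)=(A\otimes B, M\otimes N)$ with form $\langle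 m\otimes n,m'\otimes n'\rangle=\langle m,m'\rangle\langle n,n'\rangle$. *)

theory Defs
  imports Complex_Main
begin

record 'v cvs =
  vcar   :: "'v set"
  vzero  :: 'v
  vadd   :: "'v \<Rightarrow> 'v \<Rightarrow> 'v"
  vscale :: "complex \<Rightarrow> 'v \<Rightarrow> 'v"

record 'a salg = "'a cvs" +
  amul  :: "'a \<Rightarrow> 'a \<Rightarrow> 'a"
  aone  :: 'a
  astar :: "'a \<Rightarrow> 'a"

record ('a, 'm) smod = "'m cvs" +
  sform :: "'m \<Rightarrow> 'm \<Rightarrow> complex"
  sact  :: "'a \<Rightarrow> 'm \<Rightarrow> 'm"

definition cvs_space :: "('v, 'z) cvs_scheme \<Rightarrow> bool" where
  "cvs_space V \<longleftrightarrow>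
     vzero V \<in> vcar V \<and>
     (\<forall>x\<in>vcar V. \<forall>y\<in>vcar V. vadd V x y \<in> vcar V) \<and>
     (\<forall>c. \<forall>x\<in>vcar V. vscale V c x \<in> vcar V) \<and>
     (\<forall>x\<in>vcar V. \<forall>y\<in>vcar V. \<forall>z\<in>vcar V. vadd V (vadd V x y) z = vadd V x (vadd V y z)) \<and>
     (\<forall>x\<in>vcar V. \<forall>y\<in>vcar V. vadd V x y = vadd V y x) \<and>
     (\<forall>x\<in>vcar V. vadd V (vzero V) x = x) \<and>
     (\<forall>x\<in>vcar V. \<exists>y\<in>vcar V. vadd V x y = vzero V) \<and>
     (\<forall>c. \<forall>x\<in>vcar V. \<forall>y\<in>vcar V. vscale V c (vadd V x y) = vadd V (vscale V c x) (vscale V c y)) \<and>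
     (\<forall>c d. \<forall>x\<in>vcar V. vscale V (c + d) x = vadd V (vscale V c x) (vscale V d x)) \<and>
     (\<forall>c d. \<forall>x\<in>vcar V. vscale V (c * d) x = vscale V c (vscale V d x)) \<and>
     (\<forall>x\<in>vcar V. vscale V 1 x = x)"

definition vdiff :: "('v, 'z) cvs_scheme \<Rightarrow> 'v \<Rightarrow> 'v \<Rightarrow> 'v" where
  "vdiff V x y = vadd V x (vscale V (-1) y)"

definition star_algebra :: "('a, 'z) salg_scheme \<Rightarrow> bool" where
  "star_algebra A \<longleftrightarrow> cvs_space A \<and>
     aone A \<in> vcar A \<and>
     (\<forall>x\<in>vcar A. \<forall>y\<in>vcar A. amul A x y \<in> vcar A) \<and>
     (\<forall>x\<in>vcar A. \<forall>y\<in>vcar A. \<forall>z\<in>vcar A. amul A (amul A x y) z = amul A x (amul A y z)) \<and>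
     (\<forall>x\<in>vcar A. amul A (aone A) x = x \<and> amul A x (aone A) = x) \<and>
     (\<forall>x\<in>vcar A. \<forall>y\<in>vcar A. \<forall>z\<in>vcar A.
        amul A (vadd A x y) z = vadd A (amul A x z) (amul A y z) \<and>
        amul A z (vadd A x y) = vadd A (amul A z x) (amul A z y)) \<and>
     (\<forall>c. \<forall>x\<in>vcar A. \<forall>y\<in>vcar A.
        amul A (vscale A c x) y = vscale A c (amul A x y) \<and>
        amul A x (vscale A c y) = vscale A c (amul A x y)) \<and>
     (\<forall>x\<in>vcar A. astar A x \<in> vcar A) \<and>
     (\<forall>x\<in>vcar A. \<forall>y\<in>vcar A. astar A (vadd A x y) = vadd A (astar A x) (astar A y)) \<and>
     (\<forall>c. \<forall>x\<in>vcar A. astar A (vscale A c x) = vscale A (cnj c) (astar A x)) \<and>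
     (\<forall>x\<in>vcar A. astar A (astar A x) = x) \<and>
     (\<forall>x\<in>vcar A. \<forall>y\<in>vcar A. astar A (amul A x y) = amul A (astar A y) (astar A x))"

definition lin_map :: "('v, 'z) cvs_scheme \<Rightarrow> ('w, 'y) cvs_scheme \<Rightarrow> ('v \<Rightarrow> 'w) \<Rightarrow> bool" where
  "lin_map V W h \<longleftrightarrow> (\<forall>x\<in>vcar V. h x \<in> vcar W) \<and>
     (\<forall>x\<in>vcar V. \<forall>y\<in>vcar V. h (vadd V x y) = vadd W (h x) (h y)) \<and>
     (\<forall>c. \<forall>x\<in>vcar V. h (vscale V c x) = vscale W c (h x))"

definition star_hom :: "('a, 'z) salg_scheme \<Rightarrow> ('b, 'y) salg_scheme \<Rightarrow> ('a \<Rightarrow> 'b) \<Rightarrow> bool" where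
  "star_hom A B f \<longleftrightarrow> lin_map A B f \<and>
     (\<forall>x\<in>vcar A. \<forall>y\<in>vcar A. f (amul A x y) = amul B (f x) (f y)) \<and>
     f (aone A) = aone B \<and>
     (\<forall>x\<in>vcar A. f (astar A x) = astar B (f x))"

definition star_module :: "('a, 'z) salg_scheme \<Rightarrow> ('a, 'm, 'y) smod_scheme \<Rightarrow> bool" where
  "star_module A M \<longleftrightarrow> star_algebra A \<and> cvs_space M \<and>
     \<comment> \<open>Hermitian form, linear in the first variable\<close>
     (\<forall>x\<in>vcar M. \<forall>y\<in>vcar M. \<forall>z\<in>vcar M. sform M (vadd M x y) z = sform M x z + sform M y z) \<and>
     (\<forall>c. \<forall>x\<in>vcar M. \<forall>y\<in>vcar M. sform M (vscale M c x) y = c * sform M x y) \<and>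
     (\<forall>x\<in>vcar M. \<forall>y\<in>vcar M. sform M y x = cnj (sform M x y)) \<and>
     \<comment> \<open>nondegenerate\<close>
     (\<forall>x\<in>vcar M. (\<forall>y\<in>vcar M. sform M x y = 0) \<longrightarrow> x = vzero M) \<and>
     \<comment> \<open>unital left A-module\<close>
     (\<forall>a\<in>vcar A. \<forall>m\<in>vcar M. sact M a m \<in> vcar M) \<and>
     (\<forall>a\<in>vcar A. \<forall>m\<in>vcar M. \<forall>n\<in>vcar M. sact M a (vadd M m n) = vadd M (sact M a m) (sact M a n)) \<and>
     (\<forall>c. \<forall>a\<in>vcar A. \<forall>m\<in>vcar M. sact M a (vscale M c m) = vscale M c (sact M a m)) \<and>
     (\<forall>a\<in>vcar A. \<forall>b\<in>vcar A. \<forall>m\<in>vcar M. sact M (vadd A a b) m = vadd M (sact M a m) (sact M b m)) \<and>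
     (\<forall>c. \<forall>a\<in>vcar A. \<forall>m\<in>vcar M. sact M (vscale A c a) m = vscale M c (sact M a m)) \<and>
     (\<forall>a\<in>vcar A. \<forall>b\<in>vcar A. \<forall>m\<in>vcar M. sact M (amul A a b) m = sact M a (sact M b m)) \<and>
     (\<forall>m\<in>vcar M. sact M (aone A) m = m) \<and>
     \<comment> \<open>compatibility of form and involution\<close>
     (\<forall>a\<in>vcar A. \<forall>m\<in>vcar M. \<forall>n\<in>vcar M. sform M (sact M a m) n = sform M m (sact M (astar A a) n))"

definition smod_hom ::
  "('a, 'z) salg_scheme \<Rightarrow> ('a, 'm, 'y) smod_scheme \<Rightarrow>
   ('b, 'x) salg_scheme \<Rightarrow> ('b, 'n, 'w) smod_scheme \<Rightarrow> ('a \<Rightarrow> 'b) \<Rightarrow> ('m \<Rightarrow> 'n) \<Rightarrow> bool" where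
  "smod_hom A M B N f h \<longleftrightarrow> star_hom A B f \<and> lin_map M N h \<and>
     (\<forall>x\<in>vcar M. \<forall>y\<in>vcar M. sform N (h x) (h y) = sform M x y) \<and>
     (\<forall>a\<in>vcar A. \<forall>m\<in>vcar M. h (sact M a m) = sact N (f a) (h m))"

definition smod_iso ::
  "('a, 'z) salg_scheme \<Rightarrow> ('a, 'm, 'y) smod_scheme \<Rightarrow>
   ('b, 'x) salg_scheme \<Rightarrow> ('b, 'n, 'w) smod_scheme \<Rightarrow> ('a \<Rightarrow> 'b) \<Rightarrow> ('m \<Rightarrow> 'n) \<Rightarrow> bool" where
  "smod_iso A M B N f h \<longleftrightarrow> smod_hom A M B N f h \<and>
     (\<exists>f' h'. smod_hom B N A M f' h' \<and>
        (\<forall>a\<in>vcar A. f' (f a) = a) \<and> (\<forall>b\<in>vcar B. f (f' b) = b) \<and>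
        (\<forall>m\<in>vcar M. h' (h m) = m) \<and> (\<forall>n\<in>vcar N. h (h' n) = n))"

definition rep_state :: "('a, 'z) salg_scheme \<Rightarrow> ('a \<Rightarrow> complex) \<Rightarrow> bool" where
  "rep_state A \<phi> \<longleftrightarrow>
     (\<forall>x\<in>vcar A. \<forall>y\<in>vcar A. \<phi> (vadd A x y) = \<phi> x + \<phi> y) \<and>
     (\<forall>c. \<forall>x\<in>vcar A. \<phi> (vscale A c x) = c * \<phi> x) \<and>
     (\<forall>x\<in>vcar A. \<phi> (astar A x) = cnj (\<phi> x))"

definition perp :: "('a, 'z) salg_scheme \<Rightarrow> ('a \<Rightarrow> complex) \<Rightarrow> 'a set" where
  "perp A \<phi> = {a \<in> vcar A. \<forall>b\<in>vcar A. \<phi> (amul A (astar A b) a) = 0}"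

definition repr :: "'x set \<Rightarrow> 'x" where
  "repr X = (SOME x. x \<in> X)"

definition gcls :: "('a, 'z) salg_scheme \<Rightarrow> ('a \<Rightarrow> complex) \<Rightarrow> 'a \<Rightarrow> 'a set" where
  "gcls A \<phi> a = {a' \<in> vcar A. vdiff A a' a \<in> perp A \<phi>}"

definition gns :: "('a, 'z) salg_scheme \<Rightarrow> ('a \<Rightarrow> complex) \<Rightarrow> ('a, 'a set) smod" where
  "gns A \<phi> = \<lparr> vcar = gcls A \<phi> ` vcar A,
               vzero = gcls A \<phi> (vzero A),
               vadd = (\<lambda>P Q. gcls A \<phi> (vadd A (repr P) (repr Q))),
               vscale = (\<lambda>c P. gcls A \<phi> (vscale A c (repr P))),
               sform = (\<lambda>P Q. \<phi> (amul A (astar A (repr Q)) (repr P))),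
               sact = (\<lambda>a P. gcls A \<phi> (amul A a (repr P))) \<rparr>"

definition gns_map :: "('a, 'z) salg_scheme \<Rightarrow> ('a \<Rightarrow> complex) \<Rightarrow> ('b \<Rightarrow> 'a) \<Rightarrow> 'b set \<Rightarrow> 'a set" where
  "gns_map A \<phi> f P = gcls A \<phi> (f (repr P))"

definition phys_hom ::
  "('a, 'z) salg_scheme \<Rightarrow> ('a \<Rightarrow> complex) \<Rightarrow> ('b, 'y) salg_scheme \<Rightarrow> ('b \<Rightarrow> complex) \<Rightarrow> ('b \<Rightarrow> 'a) \<Rightarrow> bool" where
  "phys_hom A \<phi> B \<psi> f \<longleftrightarrow> star_hom B A f \<and>
     (\<forall>b\<in>vcar B. \<phi> (f b) = \<psi> b) \<and>
     perp B (\<lambda>b. \<phi> (f b)) \<subseteq> {b \<in> vcar B. f b \<in> perp A \<phi>}"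

section \<open>Algebraic tensor products (free vector space on V x W modulo bilinearity relations)\<close>

definition tsupp :: "('u \<Rightarrow> complex) \<Rightarrow> 'u set" where
  "tsupp x = {u. x u \<noteq> 0}"

definition tdelta :: "'u \<Rightarrow> 'u \<Rightarrow> complex" where
  "tdelta u = (\<lambda>z. if z = u then 1 else 0)"

definition tfree :: "('v, 'z) cvs_scheme \<Rightarrow> ('w, 'y) cvs_scheme \<Rightarrow> ('v \<times> 'w \<Rightarrow> complex) set" where
  "tfree V W = {x. finite (tsupp x) \<and> tsupp x \<subseteq> vcar V \<times> vcar W}"

inductive_set trel :: "('v, 'z) cvs_scheme \<Rightarrow> ('w, 'y) cvs_scheme \<Rightarrow> ('v \<times> 'w \<Rightarrow> complex) set"
  for V W where
  trel_zero: "(\<lambda>_. 0) \<in> trel V W"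
| trel_addl: "v \<in> vcar V \<Longrightarrow> v' \<in> vcar V \<Longrightarrow> w \<in> vcar W \<Longrightarrow>
     (\<lambda>z. tdelta (vadd V v v', w) z - tdelta (v, w) z - tdelta (v', w) z) \<in> trel V W"
| trel_addr: "v \<in> vcar V \<Longrightarrow> w \<in> vcar W \<Longrightarrow> w' \<in> vcar W \<Longrightarrow>
     (\<lambda>z. tdelta (v, vadd W w w') z - tdelta (v, w) z - tdelta (v, w') z) \<in> trel V W"
| trel_scalel: "v \<in> vcar V \<Longrightarrow> w \<in> vcar W \<Longrightarrow>
     (\<lambda>z. tdelta (vscale V c v, w) z - c * tdelta (v, w) z) \<in> trel V W"
| trel_scaler: "v \<in> vcar V \<Longrightarrow> w \<in> vcar W \<Longrightarrow>
     (\<lambda>z. tdelta (v, vscale W c w) z - c * tdelta (v, w) z) \<in> trel V W"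
| trel_add: "x \<in> trel V W \<Longrightarrow> y \<in> trel V W \<Longrightarrow> (\<lambda>z. x z + y z) \<in> trel V W"
| trel_scale: "x \<in> trel V W \<Longrightarrow> (\<lambda>z. c * x z) \<in> trel V W"

definition tcls :: "('v, 'z) cvs_scheme \<Rightarrow> ('w, 'y) cvs_scheme \<Rightarrow> ('v \<times> 'w \<Rightarrow> complex) \<Rightarrow> ('v \<times> 'w \<Rightarrow> complex) set" where
  "tcls V W x = {y \<in> tfree V W. (\<lambda>z. y z - x z) \<in> trel V W}"

definition tel :: "('v, 'z) cvs_scheme \<Rightarrow> ('w, 'y) cvs_scheme \<Rightarrow> 'v \<Rightarrow> 'w \<Rightarrow> ('v \<times> 'w \<Rightarrow> complex) set" where
  "tel V W v w = tcls V W (tdelta (v, w))"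

definition vtensor :: "('v, 'z) cvs_scheme \<Rightarrow> ('w, 'y) cvs_scheme \<Rightarrow> ('v \<times> 'w \<Rightarrow> complex) set cvs" where
  "vtensor V W = \<lparr> vcar = tcls V W ` tfree V W,
                   vzero = tcls V W (\<lambda>_. 0),
                   vadd = (\<lambda>X Y. tcls V W (\<lambda>z. repr X z + repr Y z)),
                   vscale = (\<lambda>c X. tcls V W (\<lambda>z. c * repr X z)) \<rparr>"

definition fpush :: "('u \<Rightarrow> 'u') \<Rightarrow> ('u \<Rightarrow> complex) \<Rightarrow> 'u' \<Rightarrow> complex" where
  "fpush p x = (\<lambda>z. \<Sum>u\<in>{u \<in> tsupp x. p u = z}. x u)"

definition fcpush :: "('u \<Rightarrow> 'u') \<Rightarrow> ('u \<Rightarrow> complex) \<Rightarrow> 'u' \<Rightarrow> complex" where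
  "fcpush p x = (\<lambda>z. \<Sum>u\<in>{u \<in> tsupp x. p u = z}. cnj (x u))"

definition fconv :: "('u \<Rightarrow> 'u' \<Rightarrow> 'u'') \<Rightarrow> ('u \<Rightarrow> complex) \<Rightarrow> ('u' \<Rightarrow> complex) \<Rightarrow> 'u'' \<Rightarrow> complex" where
  "fconv p x y = (\<lambda>z. \<Sum>(u, u')\<in>{(u, u'). u \<in> tsupp x \<and> u' \<in> tsupp y \<and> p u u' = z}. x u * y u')"

definition tmap :: "('v', 'z) cvs_scheme \<Rightarrow> ('w', 'y) cvs_scheme \<Rightarrow> ('v \<Rightarrow> 'v') \<Rightarrow> ('w \<Rightarrow> 'w') \<Rightarrow>
                    ('v \<times> 'w \<Rightarrow> complex) set \<Rightarrow> ('v' \<times> 'w' \<Rightarrow> complex) set" where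
  "tmap V' W' h k X = tcls V' W' (fpush (map_prod h k) (repr X))"

definition tensor_alg :: "('a, 'z) salg_scheme \<Rightarrow> ('b, 'y) salg_scheme \<Rightarrow> ('a \<times> 'b \<Rightarrow> complex) set salg" where
  "tensor_alg A B = \<lparr> vcar = vcar (vtensor A B),
                      vzero = vzero (vtensor A B),
                      vadd = vadd (vtensor A B),
                      vscale = vscale (vtensor A B),
                      amul = (\<lambda>X Y. tcls A B (fconv (\<lambda>(a, b) (a', b'). (amul A a a', amul B b b')) (repr X) (repr Y))),
                      aone = tel A B (aone A) (aone B),
                      astar = (\<lambda>X. tcls A B (fcpush (\<lambda>(a, b). (astar A a, astar B b)) (repr X))) \<rparr>"

definition tstate :: "('a \<Rightarrow> complex) \<Rightarrow> ('b \<Rightarrow> complex) \<Rightarrow> ('a \<times> 'b \<Rightarrow> complex) set \<Rightarrow> complex" where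
  "tstate \<phi> \<psi> X = (\<Sum>u\<in>tsupp (repr X). repr X u * \<phi> (fst u) * \<psi> (snd u))"

definition tensor_smod :: "('a, 'm, 'z) smod_scheme \<Rightarrow> ('b, 'n, 'y) smod_scheme \<Rightarrow>
                           (('a \<times> 'b \<Rightarrow> complex) set, ('m \<times> 'n \<Rightarrow> complex) set) smod" where
  "tensor_smod M N = \<lparr> vcar = vcar (vtensor M N),
                       vzero = vzero (vtensor M N),
                       vadd = vadd (vtensor M N),
                       vscale = vscale (vtensor M N),
                       sform = (\<lambda>X Y. \<Sum>u\<in>tsupp (repr X). \<Sum>u'\<in>tsupp (repr Y).
                                   repr X u * cnj (repr Y u') * sform M (fst u) (fst u') * sform N (snd u) (snd u')),
                       sact = (\<lambda>P X. tcls M N (fconv (\<lambda>(a, b) (m, n). (sact M a m, sact N b n)) (repr P) (repr X))) \<rparr>"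

definition cplx :: "complex salg" where
  "cplx = \<lparr> vcar = UNIV, vzero = 0, vadd = (+), vscale = (*), amul = (*), aone = 1, astar = cnj \<rparr>"

definition cplx_mod :: "(complex, complex) smod" where
  "cplx_mod = \<lparr> vcar = UNIV, vzero = 0, vadd = (+), vscale = (*), sform = (\<lambda>z w. z * cnj w), sact = (*) \<rparr>"

definition tassoc :: "('u, 'z) cvs_scheme \<Rightarrow> ('v, 'y) cvs_scheme \<Rightarrow> ('w, 'x) cvs_scheme \<Rightarrow>
     ((('u \<times> 'v \<Rightarrow> complex) set) \<times> 'w \<Rightarrow> complex) set \<Rightarrow> ('u \<times> ('v \<times> 'w \<Rightarrow> complex) set \<Rightarrow> complex) set" where
  "tassoc U V W X = tcls U (vtensor V W)
     (\<lambda>z. \<Sum>q\<in>tsupp (repr X). repr X q *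
            (\<Sum>p\<in>tsupp (repr (fst q)). repr (fst q) p * tdelta (fst p, tel V W (snd p) (snd q)) z))"

definition tswap :: "('w, 'y) cvs_scheme \<Rightarrow> ('v, 'z) cvs_scheme \<Rightarrow> ('v \<times> 'w \<Rightarrow> complex) set \<Rightarrow> ('w \<times> 'v \<Rightarrow> complex) set" where
  "tswap W V X = tcls W V (fpush prod.swap (repr X))"

definition lunit_inv :: "('v, 'z) cvs_scheme \<Rightarrow> 'v \<Rightarrow> (complex \<times> 'v \<Rightarrow> complex) set" where
  "lunit_inv V v = tel cplx V 1 v"

definition runit_inv :: "('v, 'z) cvs_scheme \<Rightarrow> 'v \<Rightarrow> ('v \<times> complex \<Rightarrow> complex) set" where
  "runit_inv V v = tel V cplx v 1"

definition gns_tensor :: "('a, 'z) salg_scheme \<Rightarrow> ('a \<Rightarrow> complex) \<Rightarrow> ('b, 'y) salg_scheme \<Rightarrow> ('b \<Rightarrow> complex) \<Rightarrow>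
     ('a \<times> 'b \<Rightarrow> complex) set set \<Rightarrow> ('a set \<times> 'b set \<Rightarrow> complex) set" where
  "gns_tensor A \<phi> B \<psi> W = tcls (gns A \<phi>) (gns B \<psi>) (fpush (map_prod (gcls A \<phi>) (gcls B \<psi>)) (repr (repr W)))"

definition gns_unit :: "complex \<Rightarrow> complex set" where
  "gns_unit z = gcls cplx (\<lambda>w. w) z"

end

theory Submission
  imports Defs
begin

text \<open>
  Everything reduces to one fact: the form on a tensor product of two nondegenerate spaces is
  nondegenerate. Let \<open>q\<close> be the tensor product of the two quotient maps
  \<open>A \<rightarrow> GNS(\<phi>)\<close> and \<open>B \<rightarrow> GNS(\<psi>)\<close>. It is surjective and
  carries the form of \<open>\<phi> \<otimes> \<psi>\<close> to the product form, so nondegeneracy says that its kernel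
  is exactly the radical of \<open>\<phi> \<otimes> \<psi>\<close>, and \<open>q\<close> descends to the comparison isomorphism.
  Since the comparison map sends \<open>[x]\<close> to \<open>q(x)\<close>, naturality and the coherence diagrams are
  equalities of linear maps on tensor products of the algebras themselves, which hold because they
  hold on elementary tensors.
\<close>

section \<open>Complex vector spaces with explicit carrier\<close>

text \<open>Tensor products and GNS quotients alike are sets of classes whose operations are
  evaluated at a member picked by \<open>repr\<close>, and membership is all that is known about it.
  Each formula is therefore treated as a linear function of the representative that vanishes on the
  relations. For operations in two variables (product, action, form) this looks circular: descending
  in the left variable requires bilinearity for every fixed right tensor, but that is visible only
  for elementary right tensors. Linearity in the right variable is obtained first, for fixed left
  factors, and carries bilinearity to all right tensors. The comparison map contains two nested
  choices, a member of a GNS class and then a formal combination representing it. Independence of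
  the second is the universal property; independence of the first is where the radical must be
  controlled. As the forms are indefinite, a vector \<open>v0\<close> may be isotropic and cannot be
  normalised; a second vector \<open>v\<close> with \<open>\<langle>v0, v\<rangle> = 1\<close> takes
  over that role.\<close>

lemma cvs_closed [simp]:
  assumes "cvs_space V"
  shows "vzero V \<in> vcar V"
    and "x \<in> vcar V \<Longrightarrow> y \<in> vcar V \<Longrightarrow> vadd V x y \<in> vcar V"
    and "x \<in> vcar V \<Longrightarrow> vscale V c x \<in> vcar V"
  using assms unfolding cvs_space_def by metis+

lemma cvs_zero_left [simp]: "cvs_space V \<Longrightarrow> x \<in> vcar V \<Longrightarrow> vadd V (vzero V) x = x"
  unfolding cvs_space_def by metis

lemma cvs_scale_one [simp]: "cvs_space V \<Longrightarrow> x \<in> vcar V \<Longrightarrow> vscale V 1 x = x"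
  unfolding cvs_space_def by metis

lemma cvs_comm:
  "cvs_space V \<Longrightarrow> x \<in> vcar V \<Longrightarrow> y \<in> vcar V \<Longrightarrow> vadd V x y = vadd V y x"
  unfolding cvs_space_def by metis

lemma cvs_assoc:
  "cvs_space V \<Longrightarrow> x \<in> vcar V \<Longrightarrow> y \<in> vcar V \<Longrightarrow> z \<in> vcar V \<Longrightarrow>
   vadd V (vadd V x y) z = vadd V x (vadd V y z)"
  unfolding cvs_space_def by metis

lemma cvs_left_comm:
  "cvs_space V \<Longrightarrow> x \<in> vcar V \<Longrightarrow> y \<in> vcar V \<Longrightarrow> z \<in> vcar V \<Longrightarrow>
   vadd V x (vadd V y z) = vadd V y (vadd V x z)"
  by (metis cvs_assoc cvs_comm)

lemmas cvs_ac = cvs_assoc cvs_comm cvs_left_comm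

lemma cvs_zero_right [simp]: "cvs_space V \<Longrightarrow> x \<in> vcar V \<Longrightarrow> vadd V x (vzero V) = x"
  by (metis cvs_comm cvs_closed(1) cvs_zero_left)

lemma cvs_distrib:
  "cvs_space V \<Longrightarrow> x \<in> vcar V \<Longrightarrow> y \<in> vcar V \<Longrightarrow>
   vscale V c (vadd V x y) = vadd V (vscale V c x) (vscale V c y)"
  unfolding cvs_space_def by metis

lemma cvs_scale_add:
  "cvs_space V \<Longrightarrow> x \<in> vcar V \<Longrightarrow> vscale V (c + d) x = vadd V (vscale V c x) (vscale V d x)"
  unfolding cvs_space_def by metis

lemma cvs_scale_scale [simp]:
  "cvs_space V \<Longrightarrow> x \<in> vcar V \<Longrightarrow> vscale V c (vscale V d x) = vscale V (c * d) x"
  unfolding cvs_space_def by metis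

text \<open>The axioms provide additive inverses only existentially. Cancellation identifies
  \<open>vscale V 0 x\<close> with zero, after which \<open>vscale V (-1) x\<close> serves as the
  negative everywhere.\<close>

lemma cvs_cancel:
  assumes "cvs_space V" "x \<in> vcar V" "y \<in> vcar V" "z \<in> vcar V" "vadd V x y = vadd V x z"
  shows "y = z"
proof -
  obtain x' where x': "x' \<in> vcar V" "vadd V x x' = vzero V"
    using assms(1,2) unfolding cvs_space_def by metis
  have "vadd V (vadd V x' x) u = u" if "u \<in> vcar V" for u
    using x' that assms(1,2) by (metis cvs_comm cvs_zero_left)
  then show ?thesis
    by (metis assms cvs_assoc x'(1))
qed

lemma cvs_scale_0 [simp]: "cvs_space V \<Longrightarrow> x \<in> vcar V \<Longrightarrow> vscale V 0 x = vzero V"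
  by (rule cvs_cancel[of V "vscale V 0 x"]) (simp_all flip: cvs_scale_add)

lemma cvs_scale_zero [simp]: "cvs_space V \<Longrightarrow> vscale V c (vzero V) = vzero V"
  by (rule cvs_cancel[of V "vscale V c (vzero V)"]) (simp_all flip: cvs_distrib)

lemma cvs_add_neg [simp]:
  "cvs_space V \<Longrightarrow> x \<in> vcar V \<Longrightarrow> vadd V x (vscale V (-1) x) = vzero V"
  using cvs_scale_add[of V x 1 "-1"] by simp

lemma cvs_diff_eq_zero:
  assumes "cvs_space V" "x \<in> vcar V" "y \<in> vcar V" "vadd V x (vscale V (-1) y) = vzero V"
  shows "x = y"
  by (rule cvs_cancel[of V "vscale V (-1) y"]) (use assms in \<open>simp_all add: cvs_comm\<close>)

lemma lin_mapI:
  assumes "\<And>x. x \<in> vcar V \<Longrightarrow> h x \<in> vcar W"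
    and "\<And>x y. x \<in> vcar V \<Longrightarrow> y \<in> vcar V \<Longrightarrow> h (vadd V x y) = vadd W (h x) (h y)"
    and "\<And>c x. x \<in> vcar V \<Longrightarrow> h (vscale V c x) = vscale W c (h x)"
  shows "lin_map V W h"
  using assms by (simp add: lin_map_def)

lemma lin_mapD:
  assumes "lin_map V W h"
  shows "x \<in> vcar V \<Longrightarrow> h x \<in> vcar W"
    and "x \<in> vcar V \<Longrightarrow> y \<in> vcar V \<Longrightarrow> h (vadd V x y) = vadd W (h x) (h y)"
    and "x \<in> vcar V \<Longrightarrow> h (vscale V c x) = vscale W c (h x)"
  using assms by (simp_all add: lin_map_def)

lemma lin_map_zero:
  assumes "cvs_space V" "cvs_space W" "lin_map V W h"
  shows "h (vzero V) = vzero W"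
  using lin_mapD(3)[OF assms(3), of "vzero V" 0] lin_mapD(1)[OF assms(3), of "vzero V"] assms(1,2)
  by simp

lemma lin_map_comp: "lin_map U V f \<Longrightarrow> lin_map V W g \<Longrightarrow> lin_map U W (\<lambda>x. g (f x))"
  by (simp add: lin_map_def)

definition bilinear_map ::
  "('v, 'z) cvs_scheme \<Rightarrow> ('w, 'y) cvs_scheme \<Rightarrow> ('t, 'x) cvs_scheme \<Rightarrow> ('v \<Rightarrow> 'w \<Rightarrow> 't) \<Rightarrow> bool" where
  "bilinear_map V W T \<beta> \<longleftrightarrow>
     (\<forall>v\<in>vcar V. lin_map W T (\<beta> v)) \<and> (\<forall>w\<in>vcar W. lin_map V T (\<lambda>v. \<beta> v w))"

lemma bilinear_mapD:
  assumes "bilinear_map V W T \<beta>" "v \<in> vcar V" "w \<in> vcar W"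
  shows "\<beta> v w \<in> vcar T"
    and "v' \<in> vcar V \<Longrightarrow> \<beta> (vadd V v v') w = vadd T (\<beta> v w) (\<beta> v' w)"
    and "w' \<in> vcar W \<Longrightarrow> \<beta> v (vadd W w w') = vadd T (\<beta> v w) (\<beta> v w')"
    and "\<beta> (vscale V c v) w = vscale T c (\<beta> v w)"
    and "\<beta> v (vscale W c w) = vscale T c (\<beta> v w)"
  using assms by (auto simp: bilinear_map_def lin_map_def)

lemma bilinear_mapI:
  assumes "\<And>v. v \<in> vcar V \<Longrightarrow> lin_map W T (\<beta> v)"
    and "\<And>w. w \<in> vcar W \<Longrightarrow> lin_map V T (\<lambda>v. \<beta> v w)"
  shows "bilinear_map V W T \<beta>"
  using assms by (simp add: bilinear_map_def)

text \<open>Conjugate-linear maps into a space are linear maps into its complex conjugate.\<close>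

definition cbar :: "('v, 'z) cvs_scheme \<Rightarrow> 'v cvs" where
  "cbar V = \<lparr> vcar = vcar V, vzero = vzero V, vadd = vadd V, vscale = (\<lambda>c. vscale V (cnj c)) \<rparr>"

lemma cbar_simps [simp]:
  "vcar (cbar V) = vcar V" "vzero (cbar V) = vzero V" "vadd (cbar V) = vadd V"
  "vscale (cbar V) c = vscale V (cnj c)"
  by (simp_all add: cbar_def)

lemma cvs_space_cbar [simp]: "cvs_space V \<Longrightarrow> cvs_space (cbar V)"
  by (simp (no_asm_simp) add: cvs_space_def[of "cbar V"] cvs_assoc cvs_distrib cvs_scale_add)
    (metis cvs_add_neg cvs_closed(3) cvs_comm)

lemma cplx_simps [simp]:
  "vcar cplx = UNIV" "vzero cplx = 0" "vadd cplx = (+)" "vscale cplx = (*)"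
  "amul cplx = (*)" "aone cplx = 1" "astar cplx = cnj"
  by (simp_all add: cplx_def)

lemma cvs_space_cplx [simp]: "cvs_space cplx"
  unfolding cvs_space_def by (auto simp: algebra_simps) (metis add.right_inverse)

lemma repr_in: "x \<in> X \<Longrightarrow> repr X \<in> X"
  by (auto simp: repr_def some_in_eq)

section \<open>Finitely supported functions\<close>

text \<open>The value at \<open>x\<close> of the linear extension of \<open>g\<close> from the basis
  vectors \<open>tdelta u\<close>. Pushforwards, convolutions, states and forms are all rewritten to
  it, so that their linearity in a representative is one fact.\<close>

definition lsum :: "('u \<Rightarrow> complex) \<Rightarrow> ('u \<Rightarrow> complex) \<Rightarrow> complex" where
  "lsum x g = (\<Sum>u\<in>tsupp x. x u * g u)"

text \<open>Supports can shrink when coefficients cancel, so sums over the supports of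
  \<open>x\<close>, \<open>y\<close> and their sum are compared over one common finite set.\<close>

lemma lsum_superset:
  assumes "finite S" "tsupp x \<subseteq> S"
  shows "lsum x g = (\<Sum>u\<in>S. x u * g u)"
  unfolding lsum_def by (rule sum.mono_neutral_left) (use assms in \<open>auto simp: tsupp_def\<close>)

lemma tsupp_tdelta [simp]: "tsupp (tdelta u) = {u}"
  by (auto simp: tsupp_def tdelta_def)

lemma lsum_tdelta [simp]: "lsum (tdelta u) g = g u"
  by (simp add: lsum_def) (simp add: tdelta_def)

lemma lsum_zero [simp]: "lsum (\<lambda>_. 0) g = 0"
  by (simp add: lsum_def)

lemma lsum_add:
  assumes "finite (tsupp x)" "finite (tsupp y)"
  shows "lsum (\<lambda>z. x z + y z) g = lsum x g + lsum y g"
proof -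
  have "tsupp (\<lambda>z. x z + y z) \<subseteq> tsupp x \<union> tsupp y"
    by (auto simp: tsupp_def)
  then show ?thesis
    using assms by (simp add: lsum_superset[of "tsupp x \<union> tsupp y"] sum.distrib algebra_simps)
qed

lemma lsum_scale: "lsum (\<lambda>z. c * x z) g = c * lsum x g"
proof (cases "c = 0")
  case False
  then have "tsupp (\<lambda>z. c * x z) = tsupp x"
    by (auto simp: tsupp_def)
  then show ?thesis
    by (simp add: lsum_def sum_distrib_left mult.assoc)
qed simp

lemma tfree_zero [simp]: "(\<lambda>_. 0) \<in> tfree V W"
  by (simp add: tfree_def tsupp_def)

lemma tfree_tdelta [simp]: "v \<in> vcar V \<Longrightarrow> w \<in> vcar W \<Longrightarrow> tdelta (v, w) \<in> tfree V W"
  by (simp add: tfree_def)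

lemma tfree_add [simp]:
  assumes "x \<in> tfree V W" "y \<in> tfree V W"
  shows "(\<lambda>z. x z + y z) \<in> tfree V W"
proof -
  have "tsupp (\<lambda>z. x z + y z) \<subseteq> tsupp x \<union> tsupp y"
    by (auto simp: tsupp_def)
  with assms show ?thesis
    by (auto simp: tfree_def intro: finite_subset)
qed

lemma tfree_scale [simp]:
  assumes "x \<in> tfree V W"
  shows "(\<lambda>z. c * x z) \<in> tfree V W"
proof -
  have "tsupp (\<lambda>z. c * x z) \<subseteq> tsupp x"
    by (auto simp: tsupp_def)
  with assms show ?thesis
    by (auto simp: tfree_def intro: finite_subset)
qed

lemma tfree_diff [simp]:
  assumes "x \<in> tfree V W" "y \<in> tfree V W"
  shows "(\<lambda>z. x z - y z) \<in> tfree V W"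
  using tfree_add[OF assms(1) tfree_scale[OF assms(2), of "-1"]] by simp

lemma tfree_finite: "x \<in> tfree V W \<Longrightarrow> finite (tsupp x)"
  by (simp add: tfree_def)

lemma tfree_induct [consumes 1, case_names zero add]:
  assumes "x \<in> tfree V W"
    and "P (\<lambda>_. 0)"
    and step: "\<And>c v w x. v \<in> vcar V \<Longrightarrow> w \<in> vcar W \<Longrightarrow> x \<in> tfree V W \<Longrightarrow> P x \<Longrightarrow>
           P (\<lambda>z. c * tdelta (v, w) z + x z)"
  shows "P x"
proof -
  have "\<forall>x. tsupp x = S \<longrightarrow> P x" if "finite S" "S \<subseteq> vcar V \<times> vcar W" for S
    using that
  proof (induction S rule: finite_induct)
    case empty
    show ?case
    proof (intro allI impI)
      fix x :: "'a \<times> 'b \<Rightarrow> complex" assume "tsupp x = {}"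
      then have "x = (\<lambda>_. 0)" by (metis (mono_tags) tsupp_def empty_Collect_eq)
      then show "P x" using assms(2) by simp
    qed
  next
    case (insert u S)
    show ?case
    proof (intro allI impI)
      fix x assume x: "tsupp x = insert u S"
      obtain v w where u: "u = (v, w)" by force
      \<comment> \<open>The induction runs over the support as a set; clearing one coefficient
        removes exactly \<open>u\<close> from it.\<close>
      define y where "y = x(u := 0)"
      have "tsupp y = S"
        using x insert.hyps by (auto simp: tsupp_def y_def)
      then have "P (\<lambda>z. x u * tdelta (v, w) z + y z)"
        using insert u by (intro step) (auto simp: tfree_def)
      moreover have "(\<lambda>z. x u * tdelta (v, w) z + y z) = x"
        by (auto simp: u y_def tdelta_def)
      ultimately show "P x" by simp
    qed
  qed
  with assms(1) show ?thesis unfolding tfree_def by blast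
qed

lemma tfree_lsum:
  assumes "x \<in> tfree V W" "\<And>v w. v \<in> vcar V \<Longrightarrow> w \<in> vcar W \<Longrightarrow> K (v, w) \<in> tfree V' W'"
  shows "(\<lambda>z. lsum x (\<lambda>u. K u z)) \<in> tfree V' W'"
  using assms(1)
proof (induction x rule: tfree_induct)
  case (add c v w x)
  have "lsum (\<lambda>z. c * tdelta (v, w) z + x z) (\<lambda>u. K u z) = c * K (v, w) z + lsum x (\<lambda>u. K u z)" for z
    using lsum_add[OF tfree_finite[OF tfree_scale[OF tfree_tdelta[OF add.hyps(1,2)]]] tfree_finite[OF add.hyps(3)]]
    by (simp add: lsum_scale)
  then show ?case using add assms(2) by simp
qed simp

section \<open>Tensor products of vector spaces\<close>

lemma trel_tfree:
  assumes "cvs_space V" "cvs_space W" "x \<in> trel V W"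
  shows "x \<in> tfree V W"
  using assms(3) by induction (use assms(1,2) in simp_all)

lemma trel_diff: "x \<in> trel V W \<Longrightarrow> y \<in> trel V W \<Longrightarrow> (\<lambda>z. x z - y z) \<in> trel V W"
  using trel_add[of x V W "\<lambda>z. -1 * y z"] trel_scale[of y V W "-1"] by simp

lemma tcls_self: "x \<in> tfree V W \<Longrightarrow> x \<in> tcls V W x"
  by (simp add: tcls_def trel_zero)

lemma tcls_eqI:
  assumes "(\<lambda>z. x z - y z) \<in> trel V W"
  shows "tcls V W x = tcls V W y"
proof -
  have "(\<lambda>z. u z - x z) \<in> trel V W \<longleftrightarrow> (\<lambda>z. u z - y z) \<in> trel V W" for u
    using trel_add[OF _ assms, of "\<lambda>z. u z - x z"] trel_diff[OF _ assms, of "\<lambda>z. u z - y z"]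
    by auto
  then show ?thesis by (auto simp: tcls_def)
qed

lemma repr_tcls:
  assumes "x \<in> tfree V W"
  shows "repr (tcls V W x) \<in> tfree V W" "(\<lambda>z. repr (tcls V W x) z - x z) \<in> trel V W"
proof -
  have "repr (tcls V W x) \<in> tcls V W x"
    using tcls_self[OF assms] by (rule repr_in)
  then show "repr (tcls V W x) \<in> tfree V W" "(\<lambda>z. repr (tcls V W x) z - x z) \<in> trel V W"
    by (simp_all add: tcls_def)
qed

lemma repr_tfree: "X \<in> vcar (vtensor V W) \<Longrightarrow> repr X \<in> tfree V W"
  by (auto simp: vtensor_def intro: repr_tcls(1))

lemma vcar_vtensor: "vcar (vtensor V W) = tcls V W ` tfree V W"
  by (simp add: vtensor_def)

lemma tcls_closed [simp]: "x \<in> tfree V W \<Longrightarrow> tcls V W x \<in> vcar (vtensor V W)"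
  by (simp add: vcar_vtensor)

lemma vadd_tcls:
  assumes "x \<in> tfree V W" "y \<in> tfree V W"
  shows "vadd (vtensor V W) (tcls V W x) (tcls V W y) = tcls V W (\<lambda>z. x z + y z)"
  using trel_add[OF repr_tcls(2)[OF assms(1)] repr_tcls(2)[OF assms(2)]]
  by (auto simp: vtensor_def algebra_simps intro!: tcls_eqI)

lemma vscale_tcls:
  assumes "x \<in> tfree V W"
  shows "vscale (vtensor V W) c (tcls V W x) = tcls V W (\<lambda>z. c * x z)"
  using trel_scale[OF repr_tcls(2)[OF assms], of c]
  by (auto simp: vtensor_def algebra_simps intro!: tcls_eqI)

lemma vzero_vtensor: "vzero (vtensor V W) = tcls V W (\<lambda>_. 0)"
  by (simp add: vtensor_def)

lemma cvs_space_vtensor [simp]: "cvs_space (vtensor V W)"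
proof -
  have "\<exists>y\<in>tfree V W. tcls V W (\<lambda>z. x z + y z) = tcls V W (\<lambda>_. 0)" if "x \<in> tfree V W" for x
    by (rule bexI[of _ "\<lambda>z. -1 * x z"]) (use that tfree_scale[OF that, of "-1"] in simp_all)
  then show ?thesis
    unfolding cvs_space_def vcar_vtensor
    by (simp add: vzero_vtensor vadd_tcls vscale_tcls algebra_simps)
qed

lemma tel_closed [simp]: "v \<in> vcar V \<Longrightarrow> w \<in> vcar W \<Longrightarrow> tel V W v w \<in> vcar (vtensor V W)"
  by (simp add: tel_def)

lemma bilinear_map_tel:
  assumes "cvs_space V" "cvs_space W"
  shows "bilinear_map V W (vtensor V W) (tel V W)"
proof (intro bilinear_mapI lin_mapI)
  fix v w w' assume "v \<in> vcar V" "w \<in> vcar W" "w' \<in> vcar W"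
  then show "tel V W v (vadd W w w') = vadd (vtensor V W) (tel V W v w) (tel V W v w')"
    using trel_addr[of v V w W w'] unfolding tel_def
    by (simp add: vadd_tcls) (rule tcls_eqI, simp add: algebra_simps)
next
  fix v v' w assume "v \<in> vcar V" "v' \<in> vcar V" "w \<in> vcar W"
  then show "tel V W (vadd V v v') w = vadd (vtensor V W) (tel V W v w) (tel V W v' w)"
    using trel_addl[of v V v' w W] unfolding tel_def
    by (simp add: vadd_tcls) (rule tcls_eqI, simp add: algebra_simps)
next
  fix v w c assume "v \<in> vcar V" "w \<in> vcar W"
  then show "tel V W v (vscale W c w) = vscale (vtensor V W) c (tel V W v w)"
    using trel_scaler[of v V w W c] unfolding tel_def
    by (simp add: vscale_tcls) (rule tcls_eqI)
next
  fix v w c assume "v \<in> vcar V" "w \<in> vcar W"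
  then show "tel V W (vscale V c v) w = vscale (vtensor V W) c (tel V W v w)"
    using trel_scalel[of v V w W c] unfolding tel_def
    by (simp add: vscale_tcls) (rule tcls_eqI)
qed (use assms in simp_all)

lemmas tel_linear = bilinear_mapD(2-5)[OF bilinear_map_tel]

lemma tel_zero_left:
  assumes "cvs_space V" "cvs_space W" "w \<in> vcar W"
  shows "tel V W (vzero V) w = vzero (vtensor V W)"
  using tel_linear(3)[OF assms(1,2) _ assms(3), of "vzero V" 0] assms by simp

text \<open>Scalars are absorbed into the left factor,
  \<open>c (v \<otimes> w) = (c v) \<otimes> w\<close>, and zero is itself elementary. Hence there
  is no case for scalar multiples, and an identity additive in \<open>X\<close> need only be checked
  on elementary tensors.\<close>

lemma tensor_induct [consumes 3, case_names tel add]: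
  assumes V: "cvs_space V" and W: "cvs_space W" and "X \<in> vcar (vtensor V W)"
    and tel: "\<And>v w. v \<in> vcar V \<Longrightarrow> w \<in> vcar W \<Longrightarrow> P (tel V W v w)"
    and add: "\<And>X Y. X \<in> vcar (vtensor V W) \<Longrightarrow> Y \<in> vcar (vtensor V W) \<Longrightarrow> P X \<Longrightarrow> P Y \<Longrightarrow>
                P (vadd (vtensor V W) X Y)"
  shows "P X"
proof -
  have "P (tcls V W x)" if "x \<in> tfree V W" for x
    using that
  proof (induction x rule: tfree_induct)
    case zero
    show ?case
      using tel[of "vzero V" "vzero W"] V W by (simp add: tel_zero_left vzero_vtensor)
  next
    case (add c v w x)
    have "P (tel V W (vscale V c v) w)"
      using add V by (intro tel) simp_all
    then have "P (tcls V W (\<lambda>z. c * tdelta (v, w) z))"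
      using add V W by (simp add: tel_linear(3)) (simp add: tel_def vscale_tcls)
    then show ?case
      using assms(5)[of "tcls V W (\<lambda>z. c * tdelta (v, w) z)" "tcls V W x"] add
      by (simp add: vadd_tcls)
  qed
  then show ?thesis using assms(3) by (auto simp: vcar_vtensor)
qed

text \<open>The universal property, phrased for a formula \<open>F\<close> on representatives so
  that it applies verbatim to definitions through \<open>repr\<close>. Agreement with the bilinear
  \<open>\<beta>\<close> on basis vectors makes \<open>F\<close> vanish on every generator of
  \<open>trel\<close>, so the choice of representative does not change its value.\<close>

lemma tensor_lift:
  assumes V: "cvs_space V" and W: "cvs_space W" and T: "cvs_space T"
    and F: "\<And>x. x \<in> tfree V W \<Longrightarrow> F x \<in> vcar T"
      "\<And>x y. x \<in> tfree V W \<Longrightarrow> y \<in> tfree V W \<Longrightarrow> F (\<lambda>z. x z + y z) = vadd T (F x) (F y)"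
      "\<And>c x. x \<in> tfree V W \<Longrightarrow> F (\<lambda>z. c * x z) = vscale T c (F x)"
    and \<beta>: "bilinear_map V W T \<beta>"
    and F\<beta>: "\<And>v w. v \<in> vcar V \<Longrightarrow> w \<in> vcar W \<Longrightarrow> F (tdelta (v, w)) = \<beta> v w"
  shows "lin_map (vtensor V W) T (\<lambda>X. F (repr X))"
    and "v \<in> vcar V \<Longrightarrow> w \<in> vcar W \<Longrightarrow> F (repr (tel V W v w)) = \<beta> v w"
proof -
  have zero: "F (\<lambda>_. 0) = vzero T"
    using F(3)[of "\<lambda>_. 0" 0] F(1)[of "\<lambda>_. 0"] T by simp
  have diff: "F (\<lambda>z. x z - y z) = vadd T (F x) (vscale T (-1) (F y))"
    if "x \<in> tfree V W" "y \<in> tfree V W" for x y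
    using F(2)[OF that(1) tfree_scale[OF that(2), of "-1"]] F(3)[OF that(2), of "-1"] by simp
  have ker: "F x = vzero T" if "x \<in> trel V W" for x
    using that
  proof induction
    case (trel_addl v v' w)
    then have "\<beta> v w \<in> vcar T" "\<beta> v' w \<in> vcar T" using bilinear_mapD(1)[OF \<beta>] by auto
    with trel_addl V W T show ?case
      by (simp add: diff F\<beta> bilinear_mapD(2)[OF \<beta>]) (simp add: cvs_ac)
  next
    case (trel_addr v w w')
    then have "\<beta> v w \<in> vcar T" "\<beta> v w' \<in> vcar T" using bilinear_mapD(1)[OF \<beta>] by auto
    with trel_addr V W T show ?case
      by (simp add: diff F\<beta> bilinear_mapD(3)[OF \<beta>]) (simp add: cvs_ac)
  next
    case (trel_scalel v w c)
    with V W T show ?case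
      using bilinear_mapD(1)[OF \<beta>, of v w]
      by (simp add: diff F\<beta> F(3) bilinear_mapD(4)[OF \<beta>])
        (metis cvs_add_neg cvs_closed(3) cvs_scale_scale mult_minus1)
  next
    case (trel_scaler v w c)
    with V W T show ?case
      using bilinear_mapD(1)[OF \<beta>, of v w]
      by (simp add: diff F\<beta> F(3) bilinear_mapD(5)[OF \<beta>])
        (metis cvs_add_neg cvs_closed(3) cvs_scale_scale mult_minus1)
  qed (use zero T trel_tfree[OF V W] in \<open>simp_all add: F(2,3)\<close>)
  have F_repr: "F (repr (tcls V W x)) = F x" if "x \<in> tfree V W" for x
    using ker[OF repr_tcls(2)[OF that]] repr_tcls(1)[OF that] that T
    by (auto simp: diff F(1) intro: cvs_diff_eq_zero)
  show "lin_map (vtensor V W) T (\<lambda>X. F (repr X))"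
    by (rule lin_mapI) (auto simp: vcar_vtensor F_repr F vadd_tcls vscale_tcls)
  show "F (repr (tel V W v w)) = \<beta> v w" if "v \<in> vcar V" "w \<in> vcar W"
    using that by (simp add: tel_def F_repr F\<beta>)
qed

lemma lin_map_cong:
  assumes "cvs_space V" "\<And>x. x \<in> vcar V \<Longrightarrow> f x = g x" "lin_map V W f"
  shows "lin_map V W g"
  using assms(3) unfolding lin_map_def by (simp add: assms(1,2) flip: assms(2))

lemma lin_map_add:
  assumes "cvs_space V" "cvs_space W" "lin_map V W f" "lin_map V W g"
  shows "lin_map V W (\<lambda>x. vadd W (f x) (g x))"
proof (rule lin_mapI)
  fix x y assume "x \<in> vcar V" "y \<in> vcar V"
  then show "vadd W (f (vadd V x y)) (g (vadd V x y)) =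
      vadd W (vadd W (f x) (g x)) (vadd W (f y) (g y))"
    using assms by (simp add: lin_mapD[OF assms(3)] lin_mapD[OF assms(4)] cvs_ac)
qed (use assms(1,2) in \<open>simp_all add: lin_mapD[OF assms(3)] lin_mapD[OF assms(4)] cvs_distrib\<close>)

lemma bilinear_map_cong:
  assumes "cvs_space V" "cvs_space W"
    and "\<And>v w. v \<in> vcar V \<Longrightarrow> w \<in> vcar W \<Longrightarrow> \<beta> v w = \<gamma> v w" "bilinear_map V W T \<beta>"
  shows "bilinear_map V W T \<gamma>"
proof (rule bilinear_mapI)
  show "lin_map W T (\<gamma> v)" if "v \<in> vcar V" for v
    by (rule lin_map_cong[OF assms(2), of "\<beta> v"]) (use assms(3,4) that in \<open>simp_all add: bilinear_map_def\<close>)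
  show "lin_map V T (\<lambda>v. \<gamma> v w)" if "w \<in> vcar W" for w
    by (rule lin_map_cong[OF assms(1), of "\<lambda>v. \<beta> v w"])
      (use assms(3,4) that in \<open>simp_all add: bilinear_map_def\<close>)
qed

lemma bilinear_map_add:
  assumes "cvs_space V" "cvs_space W" "cvs_space T" "bilinear_map V W T \<beta>" "bilinear_map V W T \<gamma>"
  shows "bilinear_map V W T (\<lambda>v w. vadd T (\<beta> v w) (\<gamma> v w))"
  using assms unfolding bilinear_map_def by (simp add: lin_map_add)

lemma bilinear_map_comp:
  assumes "bilinear_map V' W' T \<beta>" "lin_map V V' f" "lin_map W W' g"
  shows "bilinear_map V W T (\<lambda>v w. \<beta> (f v) (g w))"
  using assms unfolding bilinear_map_def lin_map_def by simp

text \<open>The case of a map into another tensor product that sends the basis vector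
  \<open>u\<close> to the class of \<open>K u\<close>. Here \<open>K u\<close> may be any formal
  combination, as the associator and the convolution products require.\<close>

lemma tensor_lift_tcls:
  assumes V: "cvs_space V" and W: "cvs_space W"
    and K: "\<And>v w. v \<in> vcar V \<Longrightarrow> w \<in> vcar W \<Longrightarrow> K (v, w) \<in> tfree V' W'"
    and F: "\<And>x. x \<in> tfree V W \<Longrightarrow> F x = tcls V' W' (\<lambda>z. lsum x (\<lambda>u. K u z))"
    and \<beta>: "bilinear_map V W (vtensor V' W') (\<lambda>v w. tcls V' W' (K (v, w)))"
  shows "lin_map (vtensor V W) (vtensor V' W') (\<lambda>X. F (repr X))"
    and "v \<in> vcar V \<Longrightarrow> w \<in> vcar W \<Longrightarrow> F (repr (tel V W v w)) = tcls V' W' (K (v, w))"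
proof -
  have free: "(\<lambda>z. lsum x (\<lambda>u. K u z)) \<in> tfree V' W'" if "x \<in> tfree V W" for x
    by (rule tfree_lsum[OF that]) (rule K)
  note lift = tensor_lift[OF V W cvs_space_vtensor, where F = F and \<beta> = "\<lambda>v w. tcls V' W' (K (v, w))"]
  have F1: "F x \<in> vcar (vtensor V' W')" if "x \<in> tfree V W" for x
    using that by (simp add: F free)
  have F2: "F (\<lambda>z. x z + y z) = vadd (vtensor V' W') (F x) (F y)"
    if "x \<in> tfree V W" "y \<in> tfree V W" for x y
    using that by (simp add: F free vadd_tcls lsum_add tfree_finite)
  have F3: "F (\<lambda>z. c * x z) = vscale (vtensor V' W') c (F x)" if "x \<in> tfree V W" for c x
    using that by (simp add: F free vscale_tcls lsum_scale)
  have F4: "F (tdelta (v, w)) = tcls V' W' (K (v, w))" if "v \<in> vcar V" "w \<in> vcar W" for v w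
    using that by (simp add: F)
  show "lin_map (vtensor V W) (vtensor V' W') (\<lambda>X. F (repr X))"
    by (rule lift(1)[OF F1 F2 F3 \<beta> F4])
  show "v \<in> vcar V \<Longrightarrow> w \<in> vcar W \<Longrightarrow> F (repr (tel V W v w)) = tcls V' W' (K (v, w))"
    by (rule lift(2)[OF F1 F2 F3 \<beta> F4])
qed

section \<open>Structure maps and products of tensor products\<close>

lemma fpush_lsum: "finite (tsupp x) \<Longrightarrow> fpush p x = (\<lambda>z. lsum x (\<lambda>u. tdelta (p u) z))"
  by (auto simp: fpush_def lsum_def tdelta_def sum.inter_filter intro!: ext sum.cong)

lemma fcpush_lsum: "finite (tsupp x) \<Longrightarrow> fcpush p x = (\<lambda>z. cnj (lsum x (\<lambda>u. tdelta (p u) z)))"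
  by (auto simp: fcpush_def lsum_def tdelta_def sum.inter_filter intro!: ext sum.cong)

lemma fconv_lsum:
  assumes "finite (tsupp x)" "finite (tsupp y)"
  shows "fconv p x y = (\<lambda>z. lsum x (\<lambda>u. lsum y (\<lambda>u'. tdelta (p u u') z)))"
proof
  fix z
  have "fconv p x y z = (\<Sum>q\<in>{q \<in> tsupp x \<times> tsupp y. p (fst q) (snd q) = z}. x (fst q) * y (snd q))"
    unfolding fconv_def by (rule sum.cong) auto
  also have "\<dots> = (\<Sum>q\<in>tsupp x \<times> tsupp y. x (fst q) * (y (snd q) * tdelta (p (fst q) (snd q)) z))"
    using assms by (subst sum.inter_filter) (auto simp: tdelta_def intro!: sum.cong)
  also have "\<dots> = lsum x (\<lambda>u. lsum y (\<lambda>u'. tdelta (p u u') z))"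
    by (simp add: lsum_def sum_distrib_left sum.cartesian_product case_prod_unfold)
  finally show "fconv p x y z = lsum x (\<lambda>u. lsum y (\<lambda>u'. tdelta (p u u') z))" .
qed

lemma tmap_linear:
  assumes sp: "cvs_space V" "cvs_space W" "cvs_space V'" "cvs_space W'"
    and h: "lin_map V V' h" and k: "lin_map W W' k"
  shows "lin_map (vtensor V W) (vtensor V' W') (tmap V' W' h k)"
    and "v \<in> vcar V \<Longrightarrow> w \<in> vcar W \<Longrightarrow> tmap V' W' h k (tel V W v w) = tel V' W' (h v) (k w)"
proof -
  have *: "bilinear_map V W (vtensor V' W') (\<lambda>v w. tcls V' W' (tdelta (map_prod h k (v, w))))"
    using bilinear_map_comp[OF bilinear_map_tel[OF sp(3,4)] h k] by (simp add: tel_def)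
  note lift = tensor_lift_tcls[OF sp(1,2) _ _ *, where F = "\<lambda>x. tcls V' W' (fpush (map_prod h k) x)"]
  show "lin_map (vtensor V W) (vtensor V' W') (tmap V' W' h k)"
    unfolding tmap_def[abs_def]
    by (rule lift(1)) (simp_all add: lin_mapD[OF h] lin_mapD[OF k] fpush_lsum tfree_finite)
  show "v \<in> vcar V \<Longrightarrow> w \<in> vcar W \<Longrightarrow> tmap V' W' h k (tel V W v w) = tel V' W' (h v) (k w)"
    unfolding tmap_def tel_def[of V']
    by (subst lift(2)) (simp_all add: lin_mapD[OF h] lin_mapD[OF k] fpush_lsum tfree_finite)
qed

lemma tswap_linear:
  assumes sp: "cvs_space V" "cvs_space W"
  shows "lin_map (vtensor V W) (vtensor W V) (tswap W V)"
    and "v \<in> vcar V \<Longrightarrow> w \<in> vcar W \<Longrightarrow> tswap W V (tel V W v w) = tel W V w v"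
proof -
  have *: "bilinear_map V W (vtensor W V) (\<lambda>v w. tcls W V (tdelta (prod.swap (v, w))))"
    using bilinear_map_tel[OF sp(2,1)] by (simp add: bilinear_map_def flip: tel_def)
  note lift = tensor_lift_tcls[OF sp _ _ *, where F = "\<lambda>x. tcls W V (fpush prod.swap x)"]
  show "lin_map (vtensor V W) (vtensor W V) (tswap W V)"
    unfolding tswap_def[abs_def] by (rule lift(1)) (simp_all add: fpush_lsum tfree_finite)
  show "v \<in> vcar V \<Longrightarrow> w \<in> vcar W \<Longrightarrow> tswap W V (tel V W v w) = tel W V w v"
    unfolding tswap_def tel_def[of W] by (subst lift(2)) (simp_all add: fpush_lsum tfree_finite)
qed

text \<open>The formula expands both the outer tensor and its left components through
  representatives, so the lift is applied twice: over \<open>U \<otimes> V\<close> with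
  \<open>w\<close> fixed, then over \<open>(U \<otimes> V) \<otimes> W\<close>. The second lift
  needs linearity in \<open>w\<close> for an arbitrary inner tensor \<open>Y\<close>; this spreads
  from elementary \<open>Y\<close> by additivity in \<open>Y\<close>, which the first lift
  supplies.\<close>

lemma tassoc_linear:
  assumes sp: "cvs_space U" "cvs_space V" "cvs_space W"
  shows "lin_map (vtensor (vtensor U V) W) (vtensor U (vtensor V W)) (tassoc U V W)"
    and "u \<in> vcar U \<Longrightarrow> v \<in> vcar V \<Longrightarrow> w \<in> vcar W \<Longrightarrow>
      tassoc U V W (tel (vtensor U V) W (tel U V u v) w) = tel U (vtensor V W) u (tel V W v w)"
proof -
  define k where "k w p = tdelta (fst p, tel V W (snd p) w)" for w and p :: "'a \<times> 'c"
  define K where "K q = (\<lambda>z. lsum (repr (fst q)) (\<lambda>p. k (snd q) p z))"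
    for q :: "('a \<times> 'c \<Rightarrow> complex) set \<times> 'e"
  let ?T = "vtensor U (vtensor V W)"
  have k_tfree: "k w (u, v) \<in> tfree U (vtensor V W)"
    if "w \<in> vcar W" "u \<in> vcar U" "v \<in> vcar V" for u v w
    using that by (simp add: k_def)
  have bil: "bilinear_map U V ?T (\<lambda>u v. tcls U (vtensor V W) (k w (u, v)))" if w: "w \<in> vcar W" for w
    using bilinear_map_comp[OF bilinear_map_tel[OF sp(1) cvs_space_vtensor, of V W],
        where f = "\<lambda>u. u" and g = "\<lambda>v. tel V W v w" and V = U and W = V]
      w bilinear_map_tel[OF sp(2,3)]
    by (simp add: k_def tel_def[of U] lin_map_def bilinear_map_def)
  note inner = tensor_lift_tcls[OF sp(1,2) k_tfree refl bil]
  have tel_K: "tcls U (vtensor V W) (K (tel U V u v, w)) = tel U (vtensor V W) u (tel V W v w)"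
    if "u \<in> vcar U" "v \<in> vcar V" "w \<in> vcar W" for u v w
    using inner(2)[OF that(3) _ _ that(3,1,2)] that by (simp add: K_def k_def tel_def[of U "vtensor V W"])
  have K_tfree: "K (Y, w) \<in> tfree U (vtensor V W)" if "Y \<in> vcar (vtensor U V)" "w \<in> vcar W" for Y w
    unfolding K_def fst_conv snd_conv
    by (rule tfree_lsum[OF repr_tfree[OF that(1)]]) (use that k_tfree in simp)
  have lin1: "lin_map (vtensor U V) ?T (\<lambda>Y. tcls U (vtensor V W) (K (Y, w)))" if "w \<in> vcar W" for w
    using inner(1)[OF that _ _ that] unfolding K_def fst_conv snd_conv by blast
  have lin2: "lin_map W ?T (\<lambda>w. tcls U (vtensor V W) (K (Y, w)))" if "Y \<in> vcar (vtensor U V)" for Y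
    using sp(1,2) that
  proof (induction Y rule: tensor_induct)
    case (tel u v)
    have "lin_map W ?T (\<lambda>w. tel U (vtensor V W) u (tel V W v w))"
      using tel bilinear_map_tel[OF sp(2,3)] bilinear_map_tel[OF sp(1) cvs_space_vtensor, of V W]
      by - (rule lin_map_comp[where f = "tel V W v" and g = "tel U (vtensor V W) u" and V = "vtensor V W"],
          simp_all add: bilinear_map_def)
    then show ?case
      by (rule lin_map_cong[OF sp(3), rotated]) (simp add: tel_K tel)
  next
    case (add X Y)
    show ?case
      by (rule lin_map_cong[OF sp(3) _ lin_map_add[OF sp(3) cvs_space_vtensor add.IH]])
        (simp add: lin_mapD(2)[OF lin1] add.hyps)
  qed
  have *: "bilinear_map (vtensor U V) W ?T (\<lambda>Y w. tcls U (vtensor V W) (K (Y, w)))"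
    using lin1 lin2 by (intro bilinear_mapI)
  note lift = tensor_lift_tcls[OF cvs_space_vtensor sp(3) K_tfree refl *]
  have eq: "tassoc U V W = (\<lambda>X. tcls U (vtensor V W) (\<lambda>z. lsum (repr X) (\<lambda>q. K q z)))"
    by (simp add: fun_eq_iff tassoc_def lsum_def K_def k_def)
  show "lin_map (vtensor (vtensor U V) W) ?T (tassoc U V W)"
    unfolding eq by (rule lift(1))
  show "tassoc U V W (tel (vtensor U V) W (tel U V u v) w) = tel U (vtensor V W) u (tel V W v w)"
    if "u \<in> vcar U" "v \<in> vcar V" "w \<in> vcar W"
    unfolding eq by (subst lift(2)) (simp_all add: tel_K that)
qed

text \<open>The separate target \<open>T'\<close> of the second variable allows \<open>T' = cbar T\<close>, that is, sesquilinear \<open>\<mu>\<close>.\<close>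

lemma tensor_bilift:
  assumes sp: "cvs_space A" "cvs_space B" "cvs_space M" "cvs_space N" "cvs_space T" "cvs_space T'"
    and T': "vcar T' = vcar T" "vadd T' = vadd T"
    and L: "\<And>a b. a \<in> vcar A \<Longrightarrow> b \<in> vcar B \<Longrightarrow> lin_map (vtensor M N) T' (L a b)"
    and Ltel: "\<And>m n. m \<in> vcar M \<Longrightarrow> n \<in> vcar N \<Longrightarrow> bilinear_map A B T (\<lambda>a b. L a b (tel M N m n))"
    and lin: "\<And>Y. Y \<in> vcar (vtensor M N) \<Longrightarrow> bilinear_map A B T (\<lambda>a b. L a b Y) \<Longrightarrow>
      lin_map (vtensor A B) T (\<lambda>X. \<mu> X Y)"
    and tel: "\<And>Y a b. Y \<in> vcar (vtensor M N) \<Longrightarrow> bilinear_map A B T (\<lambda>a b. L a b Y) \<Longrightarrow>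
      a \<in> vcar A \<Longrightarrow> b \<in> vcar B \<Longrightarrow> \<mu> (tel A B a b) Y = L a b Y"
  shows "Y \<in> vcar (vtensor M N) \<Longrightarrow> lin_map (vtensor A B) T (\<lambda>X. \<mu> X Y)"
    and "X \<in> vcar (vtensor A B) \<Longrightarrow> lin_map (vtensor M N) T' (\<mu> X)"
    and "Y \<in> vcar (vtensor M N) \<Longrightarrow> a \<in> vcar A \<Longrightarrow> b \<in> vcar B \<Longrightarrow> \<mu> (tel A B a b) Y = L a b Y"
proof -
  have bil: "bilinear_map A B T (\<lambda>a b. L a b Y)" if "Y \<in> vcar (vtensor M N)" for Y
    using sp(3,4) that
  proof (induction Y rule: tensor_induct)
    case (add X Y)
    show ?case
      by (rule bilinear_map_cong[OF sp(1,2) _ bilinear_map_add[OF sp(1,2,5) add.IH]])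
        (simp add: lin_mapD(2)[OF L] add.hyps T')
  qed (rule Ltel)
  show lin1: "lin_map (vtensor A B) T (\<lambda>X. \<mu> X Y)" if "Y \<in> vcar (vtensor M N)" for Y
    using lin[OF that bil[OF that]] .
  show tel': "\<mu> (tel A B a b) Y = L a b Y"
    if "Y \<in> vcar (vtensor M N)" "a \<in> vcar A" "b \<in> vcar B" for Y a b
    using tel[OF that(1) bil[OF that(1)] that(2,3)] .
  show "lin_map (vtensor M N) T' (\<mu> X)" if "X \<in> vcar (vtensor A B)"
    using sp(1,2) that
  proof (induction X rule: tensor_induct)
    case (tel a b)
    then show ?case
      by (intro lin_map_cong[OF cvs_space_vtensor _ L[of a b]]) (simp_all add: tel')
  next
    case (add X Y)
    show ?case
      by (rule lin_map_cong[OF cvs_space_vtensor _ lin_map_add[OF cvs_space_vtensor sp(6) add.IH]])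
        (simp add: lin_mapD(2)[OF lin1] add.hyps T')
  qed
qed

text \<open>Common source of the product of \<open>tensor_alg\<close> (with \<open>f\<close>,
  \<open>g\<close> the two products) and of the action of \<open>tensor_smod\<close> (with
  \<open>f\<close>, \<open>g\<close> the two actions). A convolution is an iterated
  \<open>lsum\<close>: \<open>L a b\<close> is the lift of the inner sum for fixed \<open>a\<close>,
  \<open>b\<close>, and the outer sum is lifted afterwards.\<close>

lemma tconv_bilinear:
  assumes sp: "cvs_space A" "cvs_space B" "cvs_space M" "cvs_space N" "cvs_space P" "cvs_space Q"
    and f: "bilinear_map A M P f" and g: "bilinear_map B N Q g"
  defines "\<mu> \<equiv> \<lambda>X Y. tcls P Q (fconv (\<lambda>(a, b) (m, n). (f a m, g b n)) (repr X) (repr Y))"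
  shows "bilinear_map (vtensor A B) (vtensor M N) (vtensor P Q) \<mu>"
    and "a \<in> vcar A \<Longrightarrow> b \<in> vcar B \<Longrightarrow> m \<in> vcar M \<Longrightarrow> n \<in> vcar N \<Longrightarrow>
      \<mu> (tel A B a b) (tel M N m n) = tel P Q (f a m) (g b n)"
proof -
  let ?p = "\<lambda>(a, b) (m, n). (f a m, g b n)"
  define L where "L a b Y = tcls P Q (\<lambda>z. lsum (repr Y) (\<lambda>u'. tdelta (?p (a, b) u') z))" for a b Y
  have free: "tdelta (?p (a, b) (m, n)) \<in> tfree P Q"
    if "a \<in> vcar A" "b \<in> vcar B" "m \<in> vcar M" "n \<in> vcar N" for a b m n
    using that bilinear_mapD(1)[OF f] bilinear_mapD(1)[OF g] by simp
  have bil1: "bilinear_map M N (vtensor P Q) (\<lambda>m n. tcls P Q (tdelta (?p (a, b) (m, n))))"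
    if "a \<in> vcar A" "b \<in> vcar B" for a b
    using bilinear_map_comp[OF bilinear_map_tel[OF sp(5,6)], of M "f a" N "g b"] f g that
    by (simp add: tel_def bilinear_map_def)
  note inner = tensor_lift_tcls[OF sp(3,4) free refl bil1]
  have L: "lin_map (vtensor M N) (vtensor P Q) (L a b)" if "a \<in> vcar A" "b \<in> vcar B" for a b
    using inner(1)[OF that _ _ that] unfolding L_def[abs_def] by blast
  have Ltel: "L a b (tel M N m n) = tel P Q (f a m) (g b n)"
    if "a \<in> vcar A" "b \<in> vcar B" "m \<in> vcar M" "n \<in> vcar N" for a b m n
    using inner(2)[OF that(1,2) _ _ that] by (simp add: L_def tel_def[of P])
  have bil2: "bilinear_map A B (vtensor P Q) (\<lambda>a b. L a b (tel M N m n))"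
    if "m \<in> vcar M" "n \<in> vcar N" for m n
    by (rule bilinear_map_cong[OF sp(1,2) _
          bilinear_map_comp[OF bilinear_map_tel[OF sp(5,6)], of A "\<lambda>a. f a m" B "\<lambda>b. g b n"]])
      (use f g that in \<open>simp_all add: bilinear_map_def Ltel\<close>)
  define K where "K Y u = (\<lambda>z. lsum (repr Y) (\<lambda>u'. tdelta (?p u u') z))" for Y u
  have K: "K Y (a, b) \<in> tfree P Q" if "Y \<in> vcar (vtensor M N)" "a \<in> vcar A" "b \<in> vcar B" for Y a b
    unfolding K_def by (rule tfree_lsum[OF repr_tfree[OF that(1)]]) (rule free[OF that(2,3)])
  have F: "tcls P Q (fconv ?p x (repr Y)) = tcls P Q (\<lambda>z. lsum x (\<lambda>u. K Y u z))"
    if "Y \<in> vcar (vtensor M N)" "x \<in> tfree A B" for x Y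
    using that by (simp add: fconv_lsum tfree_finite repr_tfree[THEN tfree_finite] K_def)
  have LK: "L a b Y = tcls P Q (K Y (a, b))" for a b Y
    by (simp add: L_def K_def)
  have o1: "lin_map (vtensor A B) (vtensor P Q) (\<lambda>X. \<mu> X Y)"
    if "Y \<in> vcar (vtensor M N)" "bilinear_map A B (vtensor P Q) (\<lambda>a b. L a b Y)" for Y
    unfolding \<mu>_def by (rule tensor_lift_tcls(1)[OF sp(1,2) K F]) (use that LK in simp_all)
  have o2: "\<mu> (tel A B a b) Y = L a b Y"
    if "Y \<in> vcar (vtensor M N)" "bilinear_map A B (vtensor P Q) (\<lambda>a b. L a b Y)"
      "a \<in> vcar A" "b \<in> vcar B" for Y a b
    unfolding \<mu>_def LK by (rule tensor_lift_tcls(2)[OF sp(1,2) K F]) (use that LK in simp_all)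
  note bl = tensor_bilift[OF sp(1-4) cvs_space_vtensor cvs_space_vtensor refl refl L bil2 o1 o2]
  show "bilinear_map (vtensor A B) (vtensor M N) (vtensor P Q) \<mu>"
    by (rule bilinear_mapI; rule bl; assumption)
  show "\<mu> (tel A B a b) (tel M N m n) = tel P Q (f a m) (g b n)"
    if "a \<in> vcar A" "b \<in> vcar B" "m \<in> vcar M" "n \<in> vcar N"
    using that by (subst bl(3)) (simp_all add: Ltel)
qed

section \<open>Tensor products of forms\<close>

definition sesquilinear :: "('m, 'z) cvs_scheme \<Rightarrow> ('m \<Rightarrow> 'm \<Rightarrow> complex) \<Rightarrow> bool" where
  "sesquilinear M s \<longleftrightarrow>
     (\<forall>y\<in>vcar M. lin_map M cplx (\<lambda>x. s x y)) \<and> (\<forall>x\<in>vcar M. lin_map M (cbar cplx) (s x))"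

lemma sesquilinearD:
  assumes "sesquilinear M s" "x \<in> vcar M" "y \<in> vcar M"
  shows "x' \<in> vcar M \<Longrightarrow> s (vadd M x x') y = s x y + s x' y"
    and "y' \<in> vcar M \<Longrightarrow> s x (vadd M y y') = s x y + s x y'"
    and "s (vscale M c x) y = c * s x y"
    and "s x (vscale M c y) = cnj c * s x y"
  using assms by (simp_all add: sesquilinear_def lin_map_def)

lemma bilinear_map_times:
  "lin_map V cplx f \<Longrightarrow> lin_map W cplx g \<Longrightarrow> bilinear_map V W cplx (\<lambda>v w. f v * g w)"
  "lin_map V (cbar cplx) f \<Longrightarrow> lin_map W (cbar cplx) g \<Longrightarrow> bilinear_map V W (cbar cplx) (\<lambda>v w. f v * g w)"
  by (simp_all add: bilinear_map_def lin_map_def algebra_simps)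

lemma tensor_form:
  assumes sp: "cvs_space M" "cvs_space N"
    and s: "sesquilinear M (sform M)" and t: "sesquilinear N (sform N)"
  defines "\<sigma> \<equiv> sform (tensor_smod M N)"
  shows "sesquilinear (vtensor M N) \<sigma>"
    and "m \<in> vcar M \<Longrightarrow> n \<in> vcar N \<Longrightarrow> m' \<in> vcar M \<Longrightarrow> n' \<in> vcar N \<Longrightarrow>
      \<sigma> (tel M N m n) (tel M N m' n') = sform M m m' * sform N n n'"
proof -
  \<comment> \<open>Conjugating twice conjugates only the coefficients of \<open>y\<close> and
    leaves the values of the forms alone, so \<open>G m n\<close> is conjugate linear in
    \<open>y\<close>, as a lift into \<open>cbar cplx\<close> requires.\<close>
  define G where "G m n y = cnj (lsum y (\<lambda>u. cnj (sform M m (fst u) * sform N n (snd u))))" for m n y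
  have \<sigma>: "\<sigma> X Y = lsum (repr X) (\<lambda>u. G (fst u) (snd u) (repr Y))" for X Y
    by (simp add: \<sigma>_def tensor_smod_def lsum_def G_def sum_distrib_left algebra_simps)
  have bil: "bilinear_map M N (cbar cplx) (\<lambda>m' n'. sform M m m' * sform N n n')"
    if "m \<in> vcar M" "n \<in> vcar N" for m n
    using s t that by (intro bilinear_map_times) (simp_all add: sesquilinear_def)
  have G: "lin_map (vtensor M N) (cbar cplx) (\<lambda>Y. G m n (repr Y))"
    and Gtel: "\<And>m' n'. m' \<in> vcar M \<Longrightarrow> n' \<in> vcar N \<Longrightarrow>
      G m n (repr (tel M N m' n')) = sform M m m' * sform N n n'"
    if "m \<in> vcar M" "n \<in> vcar N" for m n
  proof -
    note lift = tensor_lift[OF sp cvs_space_cbar[OF cvs_space_cplx] _ _ _ bil[OF that], where F = "G m n"]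
    show "lin_map (vtensor M N) (cbar cplx) (\<lambda>Y. G m n (repr Y))"
      by (rule lift(1)) (simp_all add: G_def lsum_add lsum_scale tfree_finite)
    show "G m n (repr (tel M N m' n')) = sform M m m' * sform N n n'"
      if "m' \<in> vcar M" "n' \<in> vcar N" for m' n'
      by (rule lift(2)) (use that in \<open>simp_all add: G_def lsum_add lsum_scale tfree_finite\<close>)
  qed
  have bil2: "bilinear_map M N cplx (\<lambda>m n. G m n (repr (tel M N m' n')))"
    if "m' \<in> vcar M" "n' \<in> vcar N" for m' n'
    by (rule bilinear_map_cong[OF sp _ bilinear_map_times(1)[of M "\<lambda>m. sform M m m'" N "\<lambda>n. sform N n n'"]])
      (use s t that in \<open>simp_all add: sesquilinear_def Gtel\<close>)
  have o1: "lin_map (vtensor M N) cplx (\<lambda>X. \<sigma> X Y)"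
    if "bilinear_map M N cplx (\<lambda>m n. G m n (repr Y))" for Y
    unfolding \<sigma>
    by (rule tensor_lift(1)[OF sp cvs_space_cplx _ _ _ that,
          where F = "\<lambda>x. lsum x (\<lambda>u. G (fst u) (snd u) (repr Y))"])
      (simp_all add: lsum_add lsum_scale tfree_finite)
  have o2: "\<sigma> (tel M N m n) Y = G m n (repr Y)"
    if "bilinear_map M N cplx (\<lambda>m n. G m n (repr Y))" "m \<in> vcar M" "n \<in> vcar N" for Y m n
    unfolding \<sigma>
    by (rule tensor_lift(2)[OF sp cvs_space_cplx _ _ _ that(1),
          where F = "\<lambda>x. lsum x (\<lambda>u. G (fst u) (snd u) (repr Y))"])
      (use that in \<open>simp_all add: lsum_add lsum_scale tfree_finite\<close>)
  note bl = tensor_bilift[OF sp sp cvs_space_cplx cvs_space_cbar[OF cvs_space_cplx] _ _ G bil2 o1 o2]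
  show "sesquilinear (vtensor M N) \<sigma>"
    unfolding sesquilinear_def
  proof (intro conjI ballI)
    show "lin_map (vtensor M N) cplx (\<lambda>X. \<sigma> X Y)" if "Y \<in> vcar (vtensor M N)" for Y
      by (rule bl(1)) (simp_all add: that)
    show "lin_map (vtensor M N) (cbar cplx) (\<sigma> X)" if "X \<in> vcar (vtensor M N)" for X
      by (rule bl(2)) (simp_all add: that)
  qed
  show "\<sigma> (tel M N m n) (tel M N m' n') = sform M m m' * sform N n n'"
    if "m \<in> vcar M" "n \<in> vcar N" "m' \<in> vcar M" "n' \<in> vcar N"
    using that bil2 by (simp add: o2 Gtel)
qed

text \<open>A presentation without coefficients, these being absorbed into the factors. The length
  of the list then counts elementary tensors and can serve as an induction measure.\<close>

definition tlist :: "('v, 'z) cvs_scheme \<Rightarrow> ('w, 'y) cvs_scheme \<Rightarrow> ('v \<times> 'w) list \<Rightarrow> ('v \<times> 'w \<Rightarrow> complex) set" where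
  "tlist V W xs = foldr (\<lambda>u. vadd (vtensor V W) (tel V W (fst u) (snd u))) xs (vzero (vtensor V W))"

lemma tlist_simps [simp]:
  "tlist V W [] = vzero (vtensor V W)"
  "tlist V W (u # xs) = vadd (vtensor V W) (tel V W (fst u) (snd u)) (tlist V W xs)"
  by (simp_all add: tlist_def)

lemma tlist_closed [simp]: "set xs \<subseteq> vcar V \<times> vcar W \<Longrightarrow> tlist V W xs \<in> vcar (vtensor V W)"
  by (induction xs) auto

lemma tlist_append:
  "set xs \<subseteq> vcar V \<times> vcar W \<Longrightarrow> set ys \<subseteq> vcar V \<times> vcar W \<Longrightarrow>
   tlist V W (xs @ ys) = vadd (vtensor V W) (tlist V W xs) (tlist V W ys)"
  by (induction xs) (auto simp: cvs_assoc)

lemma tlist_exists: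
  assumes "cvs_space V" "cvs_space W" "X \<in> vcar (vtensor V W)"
  shows "\<exists>xs. set xs \<subseteq> vcar V \<times> vcar W \<and> X = tlist V W xs"
  using assms
proof (induction X rule: tensor_induct)
  case (tel v w)
  then show ?case by (intro exI[of _ "[(v, w)]"]) simp
next
  case (add X Y)
  then obtain xs ys where "set xs \<subseteq> vcar V \<times> vcar W" "X = tlist V W xs"
      "set ys \<subseteq> vcar V \<times> vcar W" "Y = tlist V W ys"
    by blast
  then show ?case by (intro exI[of _ "xs @ ys"]) (simp add: tlist_append)
qed

lemma lin_map_tlist:
  assumes "lin_map (vtensor V W) (vtensor V' W') F"
    and "\<And>v w. v \<in> vcar V \<Longrightarrow> w \<in> vcar W \<Longrightarrow> F (tel V W v w) = tel V' W' (h v) (k w)"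
    and "set xs \<subseteq> vcar V \<times> vcar W"
  shows "F (tlist V W xs) = tlist V' W' (map (map_prod h k) xs)"
  using assms(3)
  by (induction xs)
    (auto simp: lin_map_zero[OF cvs_space_vtensor cvs_space_vtensor assms(1)] lin_mapD[OF assms(1)] assms(2))

text \<open>Induction on the number of elementary tensors. If \<open>\<langle>v0, v\<rangle> = 1\<close>, let \<open>P\<close> be the projection
  \<open>u \<mapsto> u - \<langle>u, v\<rangle> v0\<close>. Then \<open>X - (P \<otimes> 1) X = v0 \<otimes> w\<close>, where \<open>w\<close> is the contraction of \<open>X\<close> with
  \<open>v\<close>; it vanishes since it is orthogonal to everything. Hence \<open>X = (P \<otimes> 1) X\<close>, and the summand
  of \<open>X\<close> that starts with \<open>v0\<close> disappears.\<close>

lemma tensor_form_nondegenerate: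
  assumes sp: "cvs_space M" "cvs_space N"
    and s: "sesquilinear M (sform M)" and t: "sesquilinear N (sform N)"
    and ns: "\<And>x. x \<in> vcar M \<Longrightarrow> \<forall>y\<in>vcar M. sform M x y = 0 \<Longrightarrow> x = vzero M"
    and nt: "\<And>x. x \<in> vcar N \<Longrightarrow> \<forall>y\<in>vcar N. sform N x y = 0 \<Longrightarrow> x = vzero N"
    and X: "X \<in> vcar (vtensor M N)"
    and orth: "\<And>m n. m \<in> vcar M \<Longrightarrow> n \<in> vcar N \<Longrightarrow> sform (tensor_smod M N) X (tel M N m n) = 0"
  shows "X = vzero (vtensor M N)"
proof -
  let ?T = "vtensor M N" and ?\<sigma> = "sform (tensor_smod M N)"
  note \<sigma> = tensor_form[OF sp s t]
  \<comment> \<open>\<open>X\<close> stays fixed and only the list presenting it varies. Thus the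
    orthogonality hypothesis never has to be established for a new tensor; each step finds a shorter
    list for the same \<open>X\<close>.\<close>
  have "set xs \<subseteq> vcar M \<times> vcar N \<Longrightarrow> X = tlist M N xs \<Longrightarrow> X = vzero ?T" for xs
  proof (induction "length xs" arbitrary: xs)
    case (Suc k)
    then obtain v0 w0 ys where xs: "xs = (v0, w0) # ys" by (cases xs) auto
    with Suc.prems have v0: "v0 \<in> vcar M" and w0: "w0 \<in> vcar N" and ys: "set ys \<subseteq> vcar M \<times> vcar N"
      by auto
    show ?case
    proof (cases "v0 = vzero M")
      case True
      then have "X = tlist M N ys"
        using Suc.prems ys w0 sp by (simp add: xs tel_zero_left)
      with Suc.hyps xs ys show ?thesis by simp
    next
      case False
      then obtain v1 where v1: "v1 \<in> vcar M" "sform M v0 v1 \<noteq> 0"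
        using ns[OF v0] by blast
      \<comment> \<open>Rescaling to \<open>sform M v0 v = 1\<close>; the conjugate appears because
        the form is conjugate linear in its second variable.\<close>
      define v where "v = vscale M (cnj (inverse (sform M v0 v1))) v1"
      have v: "v \<in> vcar M" "sform M v0 v = 1"
        using v0 v1 sp by (simp_all add: v_def sesquilinearD(4)[OF s])
      define P where "P u = vadd M u (vscale M (- sform M u v) v0)" for u
      have P_lin: "lin_map M M P"
      proof (rule lin_mapI)
        fix x y assume "x \<in> vcar M" "y \<in> vcar M"
        then show "P (vadd M x y) = vadd M (P x) (P y)"
          using sp v0 v
          by (simp add: P_def sesquilinearD(1)[OF s] cvs_scale_add[where c = "- sform M x v" and d = "- sform M y v", simplified] cvs_ac)
      qed (use sp v0 v in \<open>simp_all add: P_def sesquilinearD(3)[OF s] cvs_distrib\<close>)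
      have Pv0: "P v0 = vzero M"
        using sp v0 v by (simp add: P_def)
      have id_lin: "lin_map N N (\<lambda>w. w)" by (simp add: lin_map_def)
      note PT = tmap_linear[OF sp sp P_lin id_lin]
      let ?P = "tmap M N P (\<lambda>w. w)"
      have "\<exists>w\<in>vcar N. Y = vadd ?T (?P Y) (tel M N v0 w) \<and>
              (\<forall>n\<in>vcar N. sform N w n = ?\<sigma> Y (tel M N v n))" if "Y \<in> vcar ?T" for Y
        using sp that
      proof (induction Y rule: tensor_induct)
        case (tel u w)
        \<comment> \<open>The coefficient \<open>sform M u v\<close> is moved from \<open>v0\<close>
          to the right factor. In this shape the remainders of all summands share the left factor
          \<open>v0\<close> and add up to one elementary tensor.\<close>
        have "tel M N u w = tel M N (vadd M (P u) (vscale M (sform M u v) v0)) w"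
          using sp tel v0 by (simp add: P_def cvs_assoc flip: cvs_scale_add)
        also have "\<dots> = vadd ?T (tel M N (P u) w) (tel M N v0 (vscale N (sform M u v) w))"
          using sp tel v0 lin_mapD(1)[OF P_lin tel(1)] by (simp add: tel_linear)
        finally have "tel M N u w = vadd ?T (?P (tel M N u w)) (tel M N v0 (vscale N (sform M u v) w))"
          unfolding PT(2)[OF tel] .
        moreover have "\<forall>n\<in>vcar N. sform N (vscale N (sform M u v) w) n = ?\<sigma> (tel M N u w) (tel M N v n)"
          using sp tel v by (simp add: \<sigma>(2) sesquilinearD(3)[OF t])
        ultimately show ?case
          using sp tel(2) by (blast intro: cvs_closed(3))
      next
        case (add Y Z)
        then obtain w w' where w: "w \<in> vcar N" "w' \<in> vcar N"
            "Y = vadd ?T (?P Y) (tel M N v0 w)" "Z = vadd ?T (?P Z) (tel M N v0 w')"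
            "\<forall>n\<in>vcar N. sform N w n = ?\<sigma> Y (tel M N v n)"
            "\<forall>n\<in>vcar N. sform N w' n = ?\<sigma> Z (tel M N v n)"
          by blast
        have PYZ: "?P Y \<in> vcar ?T" "?P Z \<in> vcar ?T" "tel M N v0 w \<in> vcar ?T" "tel M N v0 w' \<in> vcar ?T"
          using add.hyps lin_mapD(1)[OF PT(1)] v0 w by simp_all
        have "vadd ?T Y Z = vadd ?T (vadd ?T (?P Y) (tel M N v0 w)) (vadd ?T (?P Z) (tel M N v0 w'))"
          by (rule arg_cong2[OF w(3,4)])
        also have "\<dots> = vadd ?T (vadd ?T (?P Y) (?P Z)) (vadd ?T (tel M N v0 w) (tel M N v0 w'))"
          using PYZ by (simp add: cvs_assoc cvs_left_comm)
        also have "\<dots> = vadd ?T (?P (vadd ?T Y Z)) (tel M N v0 (vadd N w w'))"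
          using sp v0 w(1,2) add.hyps by (simp add: lin_mapD(2)[OF PT(1)] tel_linear(2))
        finally have "vadd ?T Y Z = vadd ?T (?P (vadd ?T Y Z)) (tel M N v0 (vadd N w w'))" .
        moreover have "\<forall>n\<in>vcar N. sform N (vadd N w w') n = ?\<sigma> (vadd ?T Y Z) (tel M N v n)"
          using sp v w(1,2,5,6) add.hyps
          by (simp add: sesquilinearD(1)[OF t] sesquilinearD(1)[OF \<sigma>(1)])
        ultimately show ?case
          using sp w(1,2) by (blast intro: cvs_closed(2))
      qed
      from this[OF X] obtain w where w: "w \<in> vcar N" "X = vadd ?T (?P X) (tel M N v0 w)"
          "\<forall>n\<in>vcar N. sform N w n = ?\<sigma> X (tel M N v n)"
        by blast
      have "w = vzero N"
        using nt[OF w(1)] w(3) orth[OF v(1)] by simp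
      moreover have "tel M N v0 (vzero N) = vzero ?T"
        using tel_linear(4)[OF sp v0 cvs_closed(1)[OF sp(2)], of 0] sp v0 by simp
      ultimately have "vadd ?T (?P X) (tel M N v0 w) = ?P X"
        using lin_mapD(1)[OF PT(1) X] by simp
      with w(2) have "X = ?P X" by (rule trans)
      also have "\<dots> = tlist M N (map (map_prod P (\<lambda>w. w)) xs)"
        using Suc.prems lin_map_tlist[OF PT Suc.prems(1)] by simp
      also have "\<dots> = tlist M N (map (map_prod P (\<lambda>w. w)) ys)"
      proof -
        have "set (map (map_prod P (\<lambda>w. w)) ys) \<subseteq> vcar M \<times> vcar N"
          using ys lin_mapD(1)[OF P_lin] by auto
        then show ?thesis using sp w0 by (simp add: xs Pv0 tel_zero_left)
      qed
      finally have "X = tlist M N (map (map_prod P (\<lambda>w. w)) ys)" .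
      moreover have "set (map (map_prod P (\<lambda>w. w)) ys) \<subseteq> vcar M \<times> vcar N"
        using ys lin_mapD(1)[OF P_lin] by auto
      ultimately show ?thesis
        using Suc.hyps(1)[of "map (map_prod P (\<lambda>w. w)) ys"] Suc.hyps(2) xs by simp
    qed
  qed simp
  then show ?thesis using tlist_exists[OF sp X] by blast
qed

section \<open>Tensor products of star algebras\<close>

text \<open>\<open>tensor_alg A B\<close> and \<open>vtensor A B\<close> are records of different
  types with the same underlying space. The relations see only carrier, addition and scalars, so
  iterated tensor products may be rewritten to use \<open>vtensor\<close> throughout.\<close>

lemma trel_subset_cong:
  assumes "vcar V = vcar V'" "vadd V = vadd V'" "vscale V = vscale V'"
    and "vcar W = vcar W'" "vadd W = vadd W'" "vscale W = vscale W'"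
  shows "trel V W \<subseteq> trel V' W'"
proof
  fix x assume "x \<in> trel V W"
  then show "x \<in> trel V' W'"
    by induction (simp_all add: assms trel.intros)
qed

lemma trel_cong:
  assumes "vcar V = vcar V'" "vadd V = vadd V'" "vscale V = vscale V'"
    and "vcar W = vcar W'" "vadd W = vadd W'" "vscale W = vscale W'"
  shows "trel V W = trel V' W'"
  using trel_subset_cong[OF assms] trel_subset_cong[OF assms[symmetric]] by blast

lemma tensor_alg_simps [simp]:
  "vcar (tensor_alg A B) = vcar (vtensor A B)" "vzero (tensor_alg A B) = vzero (vtensor A B)"
  "vadd (tensor_alg A B) = vadd (vtensor A B)" "vscale (tensor_alg A B) = vscale (vtensor A B)"
  "aone (tensor_alg A B) = tel A B (aone A) (aone B)"
  by (simp_all add: tensor_alg_def)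

lemma tensor_smod_simps [simp]:
  "vcar (tensor_smod M N) = vcar (vtensor M N)" "vzero (tensor_smod M N) = vzero (vtensor M N)"
  "vadd (tensor_smod M N) = vadd (vtensor M N)" "vscale (tensor_smod M N) = vscale (vtensor M N)"
  by (simp_all add: tensor_smod_def)

lemma tcls_tensor_alg [simp]:
  "tcls (tensor_alg A B) W = tcls (vtensor A B) W" "tcls W (tensor_alg A B) = tcls W (vtensor A B)"
  by (simp_all add: fun_eq_iff tcls_def tfree_def
      trel_cong[of "tensor_alg A B" "vtensor A B" W W] trel_cong[of W W "tensor_alg A B" "vtensor A B"])

lemma tel_tensor_alg [simp]:
  "tel (tensor_alg A B) W = tel (vtensor A B) W" "tel W (tensor_alg A B) = tel W (vtensor A B)"
  by (simp_all add: fun_eq_iff tel_def)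

lemma vtensor_tensor_alg [simp]:
  "vtensor (tensor_alg A B) W = vtensor (vtensor A B) W" "vtensor W (tensor_alg A B) = vtensor W (vtensor A B)"
  by (simp_all add: vtensor_def tfree_def)

lemma lin_map_tensor_alg [simp]:
  "lin_map (tensor_alg A B) W = lin_map (vtensor A B) W" "lin_map W (tensor_alg A B) = lin_map W (vtensor A B)"
  by (simp_all add: fun_eq_iff lin_map_def)

lemma lin_map_tensor_smod [simp]:
  "lin_map (tensor_smod A B) W = lin_map (vtensor A B) W" "lin_map W (tensor_smod A B) = lin_map W (vtensor A B)"
  by (simp_all add: fun_eq_iff lin_map_def)

lemma cvs_space_tensor_alg [simp]: "cvs_space (tensor_alg A B)"
  using cvs_space_vtensor[of A B] unfolding cvs_space_def tensor_alg_simps .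

lemma star_algebraD:
  assumes "star_algebra A"
  shows "cvs_space A" "aone A \<in> vcar A"
    and "x \<in> vcar A \<Longrightarrow> y \<in> vcar A \<Longrightarrow> amul A x y \<in> vcar A"
    and "x \<in> vcar A \<Longrightarrow> y \<in> vcar A \<Longrightarrow> z \<in> vcar A \<Longrightarrow> amul A (amul A x y) z = amul A x (amul A y z)"
    and "x \<in> vcar A \<Longrightarrow> amul A (aone A) x = x" "x \<in> vcar A \<Longrightarrow> amul A x (aone A) = x"
    and "x \<in> vcar A \<Longrightarrow> astar A x \<in> vcar A"
    and "x \<in> vcar A \<Longrightarrow> astar A (astar A x) = x"
    and "x \<in> vcar A \<Longrightarrow> y \<in> vcar A \<Longrightarrow> astar A (amul A x y) = amul A (astar A y) (astar A x)"
  using assms by (simp_all add: star_algebra_def)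

lemma amul_bilinear: "star_algebra A \<Longrightarrow> bilinear_map A A A (amul A)"
  by (simp add: star_algebra_def bilinear_map_def lin_map_def)

lemma astar_linear: "star_algebra A \<Longrightarrow> lin_map A (cbar A) (astar A)"
  by (simp add: star_algebra_def lin_map_def)

lemma star_algebraI:
  assumes "cvs_space A" "aone A \<in> vcar A" "bilinear_map A A A (amul A)" "lin_map A (cbar A) (astar A)"
    and "\<And>x y z. x \<in> vcar A \<Longrightarrow> y \<in> vcar A \<Longrightarrow> z \<in> vcar A \<Longrightarrow> amul A (amul A x y) z = amul A x (amul A y z)"
    and "\<And>x. x \<in> vcar A \<Longrightarrow> amul A (aone A) x = x" "\<And>x. x \<in> vcar A \<Longrightarrow> amul A x (aone A) = x"
    and "\<And>x. x \<in> vcar A \<Longrightarrow> astar A (astar A x) = x"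
    and "\<And>x y. x \<in> vcar A \<Longrightarrow> y \<in> vcar A \<Longrightarrow> astar A (amul A x y) = amul A (astar A y) (astar A x)"
  shows "star_algebra A"
  using assms by (simp add: star_algebra_def bilinear_map_def lin_map_def)

lemma amul_tensor:
  assumes A: "star_algebra A" and B: "star_algebra B"
  shows "bilinear_map (vtensor A B) (vtensor A B) (vtensor A B) (amul (tensor_alg A B))"
    and "a \<in> vcar A \<Longrightarrow> b \<in> vcar B \<Longrightarrow> a' \<in> vcar A \<Longrightarrow> b' \<in> vcar B \<Longrightarrow>
      amul (tensor_alg A B) (tel A B a b) (tel A B a' b') = tel A B (amul A a a') (amul B b b')"
  using tconv_bilinear[OF A[THEN star_algebraD(1)] B[THEN star_algebraD(1)]
      A[THEN star_algebraD(1)] B[THEN star_algebraD(1)] A[THEN star_algebraD(1)] B[THEN star_algebraD(1)]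
      amul_bilinear[OF A] amul_bilinear[OF B]]
  by (simp_all add: tensor_alg_def)

lemma tfree_cnj: "x \<in> tfree V W \<Longrightarrow> (\<lambda>z. cnj (x z)) \<in> tfree V W"
  by (simp add: tfree_def tsupp_def)


text \<open>\<open>fcpush\<close> conjugates coefficients as well as applying the involutions, so
  the universal property is used with target \<open>cbar (vtensor A B)\<close>.\<close>

lemma astar_tensor:
  assumes A: "star_algebra A" and B: "star_algebra B"
  shows "lin_map (vtensor A B) (cbar (vtensor A B)) (astar (tensor_alg A B))"
    and "a \<in> vcar A \<Longrightarrow> b \<in> vcar B \<Longrightarrow>
      astar (tensor_alg A B) (tel A B a b) = tel A B (astar A a) (astar B b)"
proof -
  note sp = A[THEN star_algebraD(1)] B[THEN star_algebraD(1)]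
  let ?p = "\<lambda>(a, b). (astar A a, astar B b)"
  have \<beta>: "bilinear_map A B (cbar (vtensor A B)) (\<lambda>a b. tel A B (astar A a) (astar B b))"
    using astar_linear[OF A] astar_linear[OF B] bilinear_map_tel[OF sp]
    by (simp add: bilinear_map_def lin_map_def)
  have free: "(\<lambda>z. lsum x (\<lambda>u. tdelta (?p u) z)) \<in> tfree A B" if "x \<in> tfree A B" for x
    by (rule tfree_lsum[OF that]) (simp add: star_algebraD(7)[OF A] star_algebraD(7)[OF B])
  have F1: "tcls A B (fcpush ?p x) \<in> vcar (cbar (vtensor A B))" if "x \<in> tfree A B" for x
    using that by (simp add: fcpush_lsum tfree_finite tfree_cnj free)
  have F2: "tcls A B (fcpush ?p (\<lambda>z. x z + y z)) =
      vadd (cbar (vtensor A B)) (tcls A B (fcpush ?p x)) (tcls A B (fcpush ?p y))"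
    if "x \<in> tfree A B" "y \<in> tfree A B" for x y
    using that tfree_finite[OF tfree_add[OF that]]
    by (simp add: fcpush_lsum tfree_finite tfree_cnj free vadd_tcls lsum_add)
  have F3: "tcls A B (fcpush ?p (\<lambda>z. c * x z)) = vscale (cbar (vtensor A B)) c (tcls A B (fcpush ?p x))"
    if "x \<in> tfree A B" for x c
    using that tfree_finite[OF tfree_scale[OF that]]
    by (simp add: fcpush_lsum tfree_finite tfree_cnj free vscale_tcls lsum_scale)
  have F4: "tcls A B (fcpush ?p (tdelta (a, b))) = tel A B (astar A a) (astar B b)" for a b
    by (simp add: fcpush_lsum tel_def) (simp add: tdelta_def if_distrib cong: if_cong)
  note lift = tensor_lift[OF sp cvs_space_cbar[OF cvs_space_vtensor] F1 F2 F3 \<beta> F4]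
  have eq: "astar (tensor_alg A B) = (\<lambda>X. tcls A B (fcpush ?p (repr X)))"
    by (simp add: tensor_alg_def)
  show "lin_map (vtensor A B) (cbar (vtensor A B)) (astar (tensor_alg A B))"
    unfolding eq by (rule lift(1))
  show "a \<in> vcar A \<Longrightarrow> b \<in> vcar B \<Longrightarrow>
      astar (tensor_alg A B) (tel A B a b) = tel A B (astar A a) (astar B b)"
    unfolding eq by (rule lift(2))
qed

lemma star_algebra_tensor:
  assumes A: "star_algebra A" and B: "star_algebra B"
  shows "star_algebra (tensor_alg A B)"
proof -
  let ?T = "vtensor A B" and ?m = "amul (tensor_alg A B)" and ?s = "astar (tensor_alg A B)"
  note sp = A[THEN star_algebraD(1)] B[THEN star_algebraD(1)]
  note m = bilinear_mapD(1-3)[OF amul_tensor(1)[OF A B]] amul_tensor(2)[OF A B]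
  note st = lin_mapD(1,2)[OF astar_tensor(1)[OF A B], simplified] astar_tensor(2)[OF A B]
  note clo = star_algebraD(2,3,7)[OF A] star_algebraD(2,3,7)[OF B]
  have assoc: "?m (?m X Y) Z = ?m X (?m Y Z)"
    if X: "X \<in> vcar ?T" and Y: "Y \<in> vcar ?T" and Z: "Z \<in> vcar ?T" for X Y Z
    using sp X
  proof (induction X rule: tensor_induct)
    case t1: (tel a b)
    show ?case using sp Y
    proof (induction Y rule: tensor_induct)
      case t2: (tel a' b')
      show ?case using sp Z
      proof (induction Z rule: tensor_induct)
        case (tel a'' b'')
        then show ?case
          using t1 t2 by (simp add: m clo star_algebraD(4)[OF A] star_algebraD(4)[OF B])
      qed (use t1 t2 in \<open>simp add: m clo\<close>)
    qed (use t1 Z in \<open>simp add: m clo\<close>)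
  qed (use Y Z in \<open>simp add: m clo\<close>)
  have one: "?m (tel A B (aone A) (aone B)) X = X" "?m X (tel A B (aone A) (aone B)) = X"
    if "X \<in> vcar ?T" for X
    using sp that
    by (induction X rule: tensor_induct)
      (simp_all add: m clo star_algebraD(5,6)[OF A] star_algebraD(5,6)[OF B])
  have inv: "?s (?s X) = X" if "X \<in> vcar ?T" for X
    using sp that
    by (induction X rule: tensor_induct)
      (simp_all add: st clo star_algebraD(8)[OF A] star_algebraD(8)[OF B])
  have anti: "?s (?m X Y) = ?m (?s Y) (?s X)" if X: "X \<in> vcar ?T" and Y: "Y \<in> vcar ?T" for X Y
    using sp X
  proof (induction X rule: tensor_induct)
    case t1: (tel a b)
    show ?case using sp Y
    proof (induction Y rule: tensor_induct)
      case (tel a' b')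
      then show ?case
        using t1 by (simp add: m st clo star_algebraD(9)[OF A] star_algebraD(9)[OF B])
    qed (use t1 in \<open>simp add: m st clo\<close>)
  qed (use Y in \<open>simp add: m st clo\<close>)
  show ?thesis
    by (rule star_algebraI)
      (use amul_tensor(1)[OF A B] astar_tensor(1)[OF A B] assoc one inv anti clo in
        \<open>simp_all add: bilinear_map_def lin_map_def\<close>)
qed

section \<open>Product states\<close>

lemma rep_stateD:
  assumes "rep_state A \<phi>"
  shows "lin_map A cplx \<phi>" "x \<in> vcar A \<Longrightarrow> \<phi> (astar A x) = cnj (\<phi> x)"
  using assms by (simp_all add: rep_state_def lin_map_def)

lemma tstate_linear:
  assumes sp: "cvs_space A" "cvs_space B" and \<phi>: "lin_map A cplx \<phi>" and \<psi>: "lin_map B cplx \<psi>"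
  shows "lin_map (vtensor A B) cplx (tstate \<phi> \<psi>)"
    and "a \<in> vcar A \<Longrightarrow> b \<in> vcar B \<Longrightarrow> tstate \<phi> \<psi> (tel A B a b) = \<phi> a * \<psi> b"
proof -
  have eq: "tstate \<phi> \<psi> = (\<lambda>X. lsum (repr X) (\<lambda>u. \<phi> (fst u) * \<psi> (snd u)))"
    by (simp add: fun_eq_iff tstate_def lsum_def mult.assoc)
  note lift = tensor_lift[OF sp cvs_space_cplx _ _ _ bilinear_map_times(1)[OF \<phi> \<psi>],
      where F = "\<lambda>x. lsum x (\<lambda>u. \<phi> (fst u) * \<psi> (snd u))"]
  show "lin_map (vtensor A B) cplx (tstate \<phi> \<psi>)"
    unfolding eq by (rule lift(1)) (simp_all add: lsum_add lsum_scale tfree_finite)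
  show "a \<in> vcar A \<Longrightarrow> b \<in> vcar B \<Longrightarrow> tstate \<phi> \<psi> (tel A B a b) = \<phi> a * \<psi> b"
    unfolding eq by (rule lift(2)) (simp_all add: lsum_add lsum_scale tfree_finite)
qed

lemma rep_state_tensor:
  assumes A: "star_algebra A" and B: "star_algebra B" and \<phi>: "rep_state A \<phi>" and \<psi>: "rep_state B \<psi>"
  shows "rep_state (tensor_alg A B) (tstate \<phi> \<psi>)"
proof -
  note sp = A[THEN star_algebraD(1)] B[THEN star_algebraD(1)]
  note t = tstate_linear[OF sp rep_stateD(1)[OF \<phi>] rep_stateD(1)[OF \<psi>]]
  note st = lin_mapD(1,2)[OF astar_tensor(1)[OF A B], simplified] astar_tensor(2)[OF A B]
  have "tstate \<phi> \<psi> (astar (tensor_alg A B) X) = cnj (tstate \<phi> \<psi> X)" if "X \<in> vcar (vtensor A B)" for X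
    using sp that
    by (induction X rule: tensor_induct)
      (simp_all add: st t lin_mapD(2)[OF t(1)] star_algebraD(7)[OF A] star_algebraD(7)[OF B]
        rep_stateD(2)[OF \<phi>] rep_stateD(2)[OF \<psi>])
  then show ?thesis
    using t(1) by (simp add: rep_state_def lin_map_def)
qed

section \<open>The GNS module\<close>

context
  fixes A :: "('a, 'z) salg_scheme" and \<phi>
  assumes A: "star_algebra A" and \<phi>: "rep_state A \<phi>"
begin

lemma state_mul_linear: "b \<in> vcar A \<Longrightarrow> lin_map A cplx (\<lambda>a. \<phi> (amul A b a))"
  using lin_map_comp[of A A "amul A b" cplx \<phi>] amul_bilinear[OF A] rep_stateD(1)[OF \<phi>]
  by (simp add: bilinear_map_def)

text \<open>The involution is a bijection of the carrier, so \<open>astar A b\<close> in the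
  definition of the radical may be replaced by an arbitrary \<open>b\<close>. Classes thus become
  the fibres of the map from \<open>a\<close> to the functional
  \<open>b \<mapsto> \<phi> (b a)\<close>, and independence of representatives reduces to identities
  of such functionals.\<close>

lemma gcls_eq:
  assumes "a \<in> vcar A"
  shows "gcls A \<phi> a = {a' \<in> vcar A. \<forall>b\<in>vcar A. \<phi> (amul A b a') = \<phi> (amul A b a)}"
proof -
  have "\<phi> (amul A b (vdiff A a' a)) = \<phi> (amul A b a') - \<phi> (amul A b a)" if "a' \<in> vcar A" "b \<in> vcar A" for a' b
    using lin_mapD(2,3)[OF state_mul_linear[OF that(2)]] that assms star_algebraD(1)[OF A]
    by (simp add: vdiff_def)
  moreover have "(\<forall>b\<in>vcar A. P (astar A b)) \<longleftrightarrow> (\<forall>b\<in>vcar A. P b)" for P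
    using star_algebraD(7,8)[OF A] by metis
  note this[where P = "\<lambda>b. \<phi> (amul A b (vdiff A a' a)) = 0" for a']
  moreover have "vdiff A a' a \<in> vcar A" if "a' \<in> vcar A" for a'
    using that assms star_algebraD(1)[OF A] by (simp add: vdiff_def)
  ultimately show ?thesis
    by (simp add: gcls_def perp_def cong: conj_cong)
qed

lemma gcls_eq_iff:
  assumes "a \<in> vcar A" "a' \<in> vcar A"
  shows "gcls A \<phi> a = gcls A \<phi> a' \<longleftrightarrow> (\<forall>b\<in>vcar A. \<phi> (amul A b a) = \<phi> (amul A b a'))"
proof
  assume "gcls A \<phi> a = gcls A \<phi> a'"
  moreover have "a \<in> gcls A \<phi> a" using assms by (simp add: gcls_eq)
  ultimately show "\<forall>b\<in>vcar A. \<phi> (amul A b a) = \<phi> (amul A b a')" using assms by (simp add: gcls_eq)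
qed (use assms in \<open>simp add: gcls_eq\<close>)

lemma repr_gcls:
  assumes "a \<in> vcar A"
  shows "repr (gcls A \<phi> a) \<in> vcar A" "gcls A \<phi> (repr (gcls A \<phi> a)) = gcls A \<phi> a"
    and "b \<in> vcar A \<Longrightarrow> \<phi> (amul A b (repr (gcls A \<phi> a))) = \<phi> (amul A b a)"
proof -
  have "repr (gcls A \<phi> a) \<in> gcls A \<phi> a"
    by (rule repr_in[of a]) (use assms in \<open>simp add: gcls_eq\<close>)
  then show "repr (gcls A \<phi> a) \<in> vcar A" "gcls A \<phi> (repr (gcls A \<phi> a)) = gcls A \<phi> a"
    and "b \<in> vcar A \<Longrightarrow> \<phi> (amul A b (repr (gcls A \<phi> a))) = \<phi> (amul A b a)"
    using assms by (simp_all add: gcls_eq)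
qed

lemma vcar_gns: "vcar (gns A \<phi>) = gcls A \<phi> ` vcar A"
  by (simp add: gns_def)

lemma gcls_closed [simp]: "a \<in> vcar A \<Longrightarrow> gcls A \<phi> a \<in> vcar (gns A \<phi>)"
  by (simp add: vcar_gns)

lemma vzero_gns: "vzero (gns A \<phi>) = gcls A \<phi> (vzero A)"
  by (simp add: gns_def)

lemma vadd_gns:
  assumes "a \<in> vcar A" "b \<in> vcar A"
  shows "vadd (gns A \<phi>) (gcls A \<phi> a) (gcls A \<phi> b) = gcls A \<phi> (vadd A a b)"
  using assms star_algebraD(1)[OF A]
  by (simp add: gns_def gcls_eq_iff repr_gcls lin_mapD(2)[OF state_mul_linear])

lemma vscale_gns:
  assumes "a \<in> vcar A"
  shows "vscale (gns A \<phi>) c (gcls A \<phi> a) = gcls A \<phi> (vscale A c a)"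
  using assms star_algebraD(1)[OF A]
  by (simp add: gns_def gcls_eq_iff repr_gcls lin_mapD(3)[OF state_mul_linear])

lemma state_herm:
  assumes "x \<in> vcar A" "y \<in> vcar A"
  shows "\<phi> (amul A (astar A x) y) = cnj (\<phi> (amul A (astar A y) x))"
  using rep_stateD(2)[OF \<phi>, of "amul A (astar A y) x"] assms
  by (simp add: star_algebraD(3,7-9)[OF A])

lemma sform_gns:
  assumes "a \<in> vcar A" "b \<in> vcar A"
  shows "sform (gns A \<phi>) (gcls A \<phi> a) (gcls A \<phi> b) = \<phi> (amul A (astar A b) a)"
proof -
  have "sform (gns A \<phi>) (gcls A \<phi> a) (gcls A \<phi> b) = \<phi> (amul A (astar A (repr (gcls A \<phi> b))) a)"
    using assms by (simp add: gns_def repr_gcls star_algebraD(7)[OF A])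
  \<comment> \<open>\<open>repr_gcls\<close> can replace a representative only in the right factor.
    Hermitian symmetry, applied on both sides, brings the starred one there.\<close>
  also have "\<dots> = \<phi> (amul A (astar A b) a)"
    using assms by (subst (1 2) state_herm) (simp_all add: repr_gcls star_algebraD(7)[OF A])
  finally show ?thesis .
qed

text \<open>By associativity, testing \<open>a b\<close> against \<open>c\<close> is testing
  \<open>b\<close> against \<open>c a\<close>; this is why left multiplication respects
  classes.\<close>

lemma sact_gns:
  assumes "a \<in> vcar A" "b \<in> vcar A"
  shows "sact (gns A \<phi>) a (gcls A \<phi> b) = gcls A \<phi> (amul A a b)"
  using assms
  by (simp add: gns_def gcls_eq_iff repr_gcls star_algebraD(3)[OF A] flip: star_algebraD(4)[OF A])

lemma cvs_space_gns [simp]: "cvs_space (gns A \<phi>)"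
proof -
  note sp = star_algebraD(1)[OF A]
  have "\<exists>y\<in>vcar A. gcls A \<phi> (vadd A x y) = gcls A \<phi> (vzero A)" if "x \<in> vcar A" for x
    by (rule bexI[of _ "vscale A (-1) x"]) (use sp that in simp_all)
  then show ?thesis
    unfolding cvs_space_def[of "gns A \<phi>"] vcar_gns
    using sp by (simp add: vzero_gns vadd_gns vscale_gns cvs_assoc cvs_distrib cvs_scale_add) (metis cvs_comm)
qed

lemma gcls_linear: "lin_map A (gns A \<phi>) (gcls A \<phi>)"
  by (rule lin_mapI) (simp_all add: vadd_gns vscale_gns)

lemma star_module_gns: "star_module A (gns A \<phi>)"
proof -
  note sp = star_algebraD(1)[OF A]
  note m = bilinear_mapD(2-5)[OF amul_bilinear[OF A]] star_algebraD(2-9)[OF A]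
  have nondeg: "gcls A \<phi> x = gcls A \<phi> (vzero A)"
    if "x \<in> vcar A" "\<forall>y\<in>vcar A. \<phi> (amul A (astar A y) x) = 0" for x
  proof -
    have "\<phi> (amul A y x) = 0" if "y \<in> vcar A" for y
      using \<open>\<forall>y\<in>vcar A. \<phi> (amul A (astar A y) x) = 0\<close> m(10,11) that by metis
    moreover have "\<phi> (amul A y (vzero A)) = 0" if "y \<in> vcar A" for y
      using lin_map_zero[OF sp cvs_space_cplx state_mul_linear[OF that]] by simp
    ultimately show ?thesis using that sp by (simp add: gcls_eq_iff)
  qed
  show ?thesis
    unfolding star_module_def vcar_gns
    using A sp nondeg
    by (simp add: vzero_gns vadd_gns vscale_gns sform_gns sact_gns m lin_mapD(2,3)[OF rep_stateD(1)[OF \<phi>]]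
        state_herm[symmetric])
qed

end

section \<open>Module isomorphisms and the functor on morphisms\<close>

lemma star_moduleD:
  assumes "star_module A M"
  shows "cvs_space M" and "sesquilinear M (sform M)"
    and "x \<in> vcar M \<Longrightarrow> \<forall>y\<in>vcar M. sform M x y = 0 \<Longrightarrow> x = vzero M"
    and "bilinear_map A M M (sact M)"
proof -
  show sp: "cvs_space M"
    using assms unfolding star_module_def by blast
  have s: "\<And>x y z. x \<in> vcar M \<Longrightarrow> y \<in> vcar M \<Longrightarrow> z \<in> vcar M \<Longrightarrow> sform M (vadd M x y) z = sform M x z + sform M y z"
    "\<And>c x y. x \<in> vcar M \<Longrightarrow> y \<in> vcar M \<Longrightarrow> sform M (vscale M c x) y = c * sform M x y"
    and herm: "\<And>x y. x \<in> vcar M \<Longrightarrow> y \<in> vcar M \<Longrightarrow> sform M y x = cnj (sform M x y)"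
    using assms unfolding star_module_def by metis+
  have "sform M x (vadd M y z) = sform M x y + sform M x z" "sform M x (vscale M c y) = cnj c * sform M x y"
    if "x \<in> vcar M" "y \<in> vcar M" "z \<in> vcar M" for x y z c
    using that sp herm[of "vadd M y z" x] herm[of y x] herm[of z x] herm[of "vscale M c y" x]
    by (simp_all add: s)
  then show "sesquilinear M (sform M)"
    using sp by (simp add: sesquilinear_def lin_map_def s)
  show "x \<in> vcar M \<Longrightarrow> \<forall>y\<in>vcar M. sform M x y = 0 \<Longrightarrow> x = vzero M"
    using assms unfolding star_module_def by metis
  have "\<forall>a\<in>vcar A. \<forall>m\<in>vcar M. sact M a m \<in> vcar M"
    "\<forall>a\<in>vcar A. \<forall>m\<in>vcar M. \<forall>n\<in>vcar M. sact M a (vadd M m n) = vadd M (sact M a m) (sact M a n)"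
    "\<forall>c. \<forall>a\<in>vcar A. \<forall>m\<in>vcar M. sact M a (vscale M c m) = vscale M c (sact M a m)"
    "\<forall>a\<in>vcar A. \<forall>b\<in>vcar A. \<forall>m\<in>vcar M. sact M (vadd A a b) m = vadd M (sact M a m) (sact M b m)"
    "\<forall>c. \<forall>a\<in>vcar A. \<forall>m\<in>vcar M. sact M (vscale A c a) m = vscale M c (sact M a m)"
    using assms unfolding star_module_def by - (elim conjE, assumption)+
  then show "bilinear_map A M M (sact M)"
    unfolding bilinear_map_def lin_map_def by simp
qed

text \<open>The set-theoretic inverse inherits linearity, isometry and equivariance: each is an
  identity in \<open>M\<close> that injectivity of \<open>h\<close> detects after transport to
  \<open>N\<close>.\<close>

lemma smod_iso_if_bij:
  assumes M: "star_module A M" and h: "smod_hom A M A N (\<lambda>x. x) h" and bij: "bij_betw h (vcar M) (vcar N)"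
  shows "smod_iso A M A N (\<lambda>x. x) h"
proof -
  let ?g = "inv_into (vcar M) h"
  note sp = star_moduleD(1)[OF M]
  have g: "?g n \<in> vcar M" "h (?g n) = n" if "n \<in> vcar N" for n
    using that bij by (simp_all add: bij_betw_def inv_into_into f_inv_into_f)
  have gh: "?g (h m) = m" if "m \<in> vcar M" for m
    using that bij by (simp add: bij_betw_def)
  have hD: "lin_map M N h" "\<And>x y. x \<in> vcar M \<Longrightarrow> y \<in> vcar M \<Longrightarrow> sform N (h x) (h y) = sform M x y"
    "\<And>a m. a \<in> vcar A \<Longrightarrow> m \<in> vcar M \<Longrightarrow> h (sact M a m) = sact N a (h m)" "star_hom A A (\<lambda>x. x)"
    using h by (simp_all add: smod_hom_def)
  have g_add: "?g (vadd N x y) = vadd M (?g x) (?g y)" if "x \<in> vcar N" "y \<in> vcar N" for x y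
    using gh[of "vadd M (?g x) (?g y)"] g that sp by (simp add: lin_mapD[OF hD(1)])
  have g_scale: "?g (vscale N c x) = vscale M c (?g x)" if "x \<in> vcar N" for c x
    using gh[of "vscale M c (?g x)"] g that sp by (simp add: lin_mapD[OF hD(1)])
  have g_act: "?g (sact N a x) = sact M a (?g x)" if "a \<in> vcar A" "x \<in> vcar N" for a x
    using gh[of "sact M a (?g x)"] g that bilinear_mapD(1)[OF star_moduleD(4)[OF M]] by (simp add: hD(3))
  have "sform M (?g x) (?g y) = sform N x y" if "x \<in> vcar N" "y \<in> vcar N" for x y
    using hD(2)[of "?g x" "?g y"] g that by simp
  then have "smod_hom A N A M (\<lambda>x. x) ?g"
    unfolding smod_hom_def using g g_add g_scale g_act hD(4) by (auto intro: lin_mapI)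
  then show ?thesis
    unfolding smod_iso_def using h g gh by blast
qed

lemma star_hom_id: "star_hom A A (\<lambda>x. x)"
  by (simp add: star_hom_def lin_map_def)

text \<open>This is where admissibility enters: the chosen member of the class of \<open>x\<close>
  differs from \<open>x\<close> by an element of the radical of \<open>\<psi>\<close>, which is the
  radical of \<open>\<phi> \<circ> f\<close>, and admissibility says that \<open>f\<close> carries
  this into the radical of \<open>\<phi>\<close>.\<close>

lemma gns_map_gcls:
  assumes A: "star_algebra A" and \<phi>: "rep_state A \<phi>" and B: "star_algebra B" and \<psi>: "rep_state B \<psi>"
    and f: "phys_hom A \<phi> B \<psi> f" and x: "x \<in> vcar B"
  shows "gns_map A \<phi> f (gcls B \<psi> x) = gcls A \<phi> (f x)"
proof -
  let ?y = "repr (gcls B \<psi> x)"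
  have y: "?y \<in> vcar B" using repr_gcls(1)[OF B \<psi> x] .
  have lin: "lin_map B A f" and state: "\<And>b. b \<in> vcar B \<Longrightarrow> \<phi> (f b) = \<psi> b"
    and adm: "perp B (\<lambda>b. \<phi> (f b)) \<subseteq> {b \<in> vcar B. f b \<in> perp A \<phi>}"
    using f by (simp_all add: phys_hom_def star_hom_def)
  have "?y \<in> gcls B \<psi> x"
    by (rule repr_in[of x]) (use x in \<open>simp add: gcls_eq[OF B \<psi>]\<close>)
  then have "vdiff B ?y x \<in> perp B \<psi>" by (simp add: gcls_def)
  moreover have "perp B \<psi> = perp B (\<lambda>b. \<phi> (f b))"
    unfolding perp_def by (rule Collect_cong) (auto simp: state star_algebraD(3,7)[OF B])
  ultimately have "f (vdiff B ?y x) \<in> perp A \<phi>" using adm by blast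
  moreover have "f (vdiff B ?y x) = vdiff A (f ?y) (f x)"
    using x y star_algebraD(1)[OF B] by (simp add: vdiff_def lin_mapD[OF lin])
  ultimately have "f ?y \<in> gcls A \<phi> (f x)"
    using y lin_mapD(1)[OF lin] by (simp add: gcls_def)
  then show ?thesis
    using x y lin_mapD(1)[OF lin] by (simp add: gns_map_def gcls_eq[OF A \<phi>])
qed

text \<open>Preservation of the form is the chain \<open>\<phi> (amul A (astar A (f y)) (f x)) =
  \<phi> (f (amul B (astar B y) x)) = \<psi> (amul B (astar B y) x)\<close>; the other clauses are
  read off representatives.\<close>

lemma smod_hom_gns_map:
  assumes A: "star_algebra A" and \<phi>: "rep_state A \<phi>" and B: "star_algebra B" and \<psi>: "rep_state B \<psi>"
    and f: "phys_hom A \<phi> B \<psi> f"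
  shows "smod_hom B (gns B \<psi>) A (gns A \<phi>) f (gns_map A \<phi> f)"
proof -
  note gm = gns_map_gcls[OF A \<phi> B \<psi> f]
  note sp = star_algebraD(1)[OF B]
  have hom: "star_hom B A f" and lin: "lin_map B A f" and state: "\<And>b. b \<in> vcar B \<Longrightarrow> \<phi> (f b) = \<psi> b"
    using f by (simp_all add: phys_hom_def star_hom_def)
  have mul: "\<And>x y. x \<in> vcar B \<Longrightarrow> y \<in> vcar B \<Longrightarrow> amul A (f x) (f y) = f (amul B x y)"
    "\<And>x. x \<in> vcar B \<Longrightarrow> astar A (f x) = f (astar B x)"
    using hom by (simp_all add: star_hom_def)
  show ?thesis
    unfolding smod_hom_def lin_map_def vcar_gns[OF B \<psi>]
    using hom sp
    by (auto simp: gm vadd_gns[OF B \<psi>] vscale_gns[OF B \<psi>] sform_gns[OF B \<psi>] sact_gns[OF B \<psi>]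
        vadd_gns[OF A \<phi>] vscale_gns[OF A \<phi>] sform_gns[OF A \<phi>] sact_gns[OF A \<phi>] gcls_closed[OF A \<phi>]
        lin_mapD[OF lin] mul state star_algebraD(3,7)[OF B])
qed

lemma gns_carrierD:
  assumes "star_algebra A" "rep_state A \<phi>" "P \<in> vcar (gns A \<phi>)"
  shows "repr P \<in> vcar A" "gcls A \<phi> (repr P) = P"
  using assms(3) repr_gcls(1,2)[OF assms(1,2)] by (auto simp: vcar_gns[OF assms(1,2)])

section \<open>The tensor comparison\<close>

context
  fixes A :: "('a, 'z) salg_scheme" and \<phi> and B :: "('b, 'y) salg_scheme" and \<psi>
  assumes A: "star_algebra A" and \<phi>: "rep_state A \<phi>" and B: "star_algebra B" and \<psi>: "rep_state B \<psi>"
begin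

abbreviation (input) qmap :: "('a \<times> 'b \<Rightarrow> complex) set \<Rightarrow> ('a set \<times> 'b set \<Rightarrow> complex) set" where
  "qmap \<equiv> tmap (gns A \<phi>) (gns B \<psi>) (gcls A \<phi>) (gcls B \<psi>)"

text \<open>Separates the two nested choices: the outer \<open>repr\<close> picks a member of the
  GNS class, the inner one belongs to \<open>tmap\<close> and is already harmless.\<close>

lemma gns_tensor_repr: "gns_tensor A \<phi> B \<psi> W = qmap (repr W)"
  by (simp add: gns_tensor_def tmap_def)

lemma qmap_linear: "lin_map (vtensor A B) (vtensor (gns A \<phi>) (gns B \<psi>)) qmap"
  and qmap_tel: "a \<in> vcar A \<Longrightarrow> b \<in> vcar B \<Longrightarrow>
    qmap (tel A B a b) = tel (gns A \<phi>) (gns B \<psi>) (gcls A \<phi> a) (gcls B \<psi> b)"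
  using tmap_linear[OF star_algebraD(1)[OF A] star_algebraD(1)[OF B] cvs_space_gns[OF A \<phi>]
      cvs_space_gns[OF B \<psi>] gcls_linear[OF A \<phi>] gcls_linear[OF B \<psi>]]
  by blast+

text \<open>Both sides are additive in \<open>X\<close> and in \<open>Y\<close>, and on elementary
  tensors both equal the product of \<open>\<phi> (amul A (astar A a') a)\<close> and
  \<open>\<psi> (amul B (astar B b') b)\<close>.\<close>

lemma qmap_isometry:
  assumes X: "X \<in> vcar (vtensor A B)" and Y: "Y \<in> vcar (vtensor A B)"
  shows "sform (tensor_smod (gns A \<phi>) (gns B \<psi>)) (qmap X) (qmap Y) =
    tstate \<phi> \<psi> (amul (tensor_alg A B) (astar (tensor_alg A B) Y) X)"
proof -
  note sp = A[THEN star_algebraD(1)] B[THEN star_algebraD(1)]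
  note mA = star_moduleD[OF star_module_gns[OF A \<phi>]] and mB = star_moduleD[OF star_module_gns[OF B \<psi>]]
  note \<sigma> = tensor_form[OF mA(1) mB(1) mA(2) mB(2)]
  note q = lin_mapD(1,2)[OF qmap_linear] qmap_tel
  note m = bilinear_mapD(1-3)[OF amul_tensor(1)[OF A B]] amul_tensor(2)[OF A B]
  note st = lin_mapD(1,2)[OF astar_tensor(1)[OF A B], simplified] astar_tensor(2)[OF A B]
  note t = tstate_linear[OF sp rep_stateD(1)[OF \<phi>] rep_stateD(1)[OF \<psi>]]
  note clo = star_algebraD(3,7)[OF A] star_algebraD(3,7)[OF B]
  show ?thesis using sp X
  proof (induction X rule: tensor_induct)
    case t1: (tel a b)
    show ?case using sp Y
    proof (induction Y rule: tensor_induct)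
      case (tel a' b')
      then show ?case
        using t1
        by (simp add: q \<sigma>(2) m st t(2) clo gcls_closed[OF A \<phi>] gcls_closed[OF B \<psi>] sform_gns[OF A \<phi>] sform_gns[OF B \<psi>])
    qed (use t1 in \<open>simp add: q m st clo lin_mapD(2)[OF t(1)] sesquilinearD(2)[OF \<sigma>(1)]
            gcls_closed[OF A \<phi>] gcls_closed[OF B \<psi>]\<close>)
  qed (use Y in \<open>simp add: q m st clo lin_mapD(2)[OF t(1)] sesquilinearD(1)[OF \<sigma>(1)]\<close>)
qed

lemmas tensor_phys = star_algebra_tensor[OF A B] rep_state_tensor[OF A B \<phi> \<psi>]

text \<open>The representative of the class is arbitrary, hence the radical of \<open>\<phi> \<otimes> \<psi>\<close> must be
  mapped to zero; it is, because the form on the tensor product of the GNS modules is nondegenerate.\<close>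

lemma gns_tensor_gcls:
  assumes X: "X \<in> vcar (vtensor A B)"
  shows "gns_tensor A \<phi> B \<psi> (gcls (tensor_alg A B) (tstate \<phi> \<psi>) X) = qmap X"
proof -
  let ?T = "vtensor A B" and ?G = "vtensor (gns A \<phi>) (gns B \<psi>)"
  let ?Y = "repr (gcls (tensor_alg A B) (tstate \<phi> \<psi>) X)"
  note mA = star_moduleD[OF star_module_gns[OF A \<phi>]] and mB = star_moduleD[OF star_module_gns[OF B \<psi>]]
  note rep = repr_gcls[OF tensor_phys, of X, simplified, OF X]
  define D where "D = vadd ?T ?Y (vscale ?T (-1) X)"
  have D: "D \<in> vcar ?T" using X rep(1) by (simp add: D_def)
  have orth: "tstate \<phi> \<psi> (amul (tensor_alg A B) Z D) = 0" if "Z \<in> vcar ?T" for Z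
    using lin_mapD(2,3)[OF state_mul_linear[OF tensor_phys, of Z]] that X rep(1,3) by (simp add: D_def)
  have "qmap D = vzero ?G"
  proof (rule tensor_form_nondegenerate[OF mA(1) mB(1) mA(2) mB(2) mA(3) mB(3)])
    show "qmap D \<in> vcar ?G" using lin_mapD(1)[OF qmap_linear D] .
    fix P Q assume "P \<in> vcar (gns A \<phi>)" "Q \<in> vcar (gns B \<psi>)"
    then obtain a b where ab: "a \<in> vcar A" "b \<in> vcar B" "P = gcls A \<phi> a" "Q = gcls B \<psi> b"
      by (auto simp: vcar_gns[OF A \<phi>] vcar_gns[OF B \<psi>])
    \<comment> \<open>An elementary tensor of classes is \<open>qmap\<close> of an elementary
      tensor, so by the isometry the pairing is a value of the product state on a left multiple of
      \<open>D\<close>; these values vanish.\<close>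
    show "sform (tensor_smod (gns A \<phi>) (gns B \<psi>)) (qmap D) (tel (gns A \<phi>) (gns B \<psi>) P Q) = 0"
      using qmap_isometry[OF D, of "tel A B a b"] ab orth
        star_algebraD(7)[OF tensor_phys(1), of "tel A B a b"]
      by (simp add: qmap_tel)
  qed
  then have "vadd ?G (qmap ?Y) (vscale ?G (-1) (qmap X)) = vzero ?G"
    using X rep(1) by (simp add: D_def lin_mapD(2,3)[OF qmap_linear])
  then show ?thesis
    using X rep(1) lin_mapD(1)[OF qmap_linear] unfolding gns_tensor_repr
    by - (rule cvs_diff_eq_zero[of ?G], simp_all)
qed

text \<open>Nondegeneracy has been spent on well-definedness. Injectivity follows from the isometry,
  since equal images have equal pairings with everything and hence come from the same class. For
  surjectivity, the image of \<open>qmap\<close> is closed under addition and contains all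
  elementary tensors.\<close>

lemma smod_iso_gns_tensor:
  "smod_iso (tensor_alg A B) (gns (tensor_alg A B) (tstate \<phi> \<psi>))
     (tensor_alg A B) (tensor_smod (gns A \<phi>) (gns B \<psi>)) (\<lambda>x. x) (gns_tensor A \<phi> B \<psi>)"
proof (rule smod_iso_if_bij[OF star_module_gns[OF tensor_phys]])
  let ?T = "vtensor A B" and ?G = "vtensor (gns A \<phi>) (gns B \<psi>)"
  let ?N = "tensor_smod (gns A \<phi>) (gns B \<psi>)" and ?cl = "gcls (tensor_alg A B) (tstate \<phi> \<psi>)"
  note sp = A[THEN star_algebraD(1)] B[THEN star_algebraD(1)]
  note mA = star_moduleD[OF star_module_gns[OF A \<phi>]] and mB = star_moduleD[OF star_module_gns[OF B \<psi>]]
  note car = vcar_gns[OF tensor_phys, simplified]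
  have act: "qmap (amul (tensor_alg A B) X Y) = sact ?N X (qmap Y)"
    if X: "X \<in> vcar ?T" and Y: "Y \<in> vcar ?T" for X Y
  proof -
    note q = lin_mapD(1,2)[OF qmap_linear] qmap_tel
    note m = bilinear_mapD(1-3)[OF amul_tensor(1)[OF A B]] amul_tensor(2)[OF A B]
    have s1: "bilinear_map ?T ?G ?G (sact ?N)"
      and s2: "\<And>a b x y. a \<in> vcar A \<Longrightarrow> b \<in> vcar B \<Longrightarrow> x \<in> vcar (gns A \<phi>) \<Longrightarrow> y \<in> vcar (gns B \<psi>) \<Longrightarrow>
        sact ?N (tel A B a b) (tel (gns A \<phi>) (gns B \<psi>) x y) =
        tel (gns A \<phi>) (gns B \<psi>) (sact (gns A \<phi>) a x) (sact (gns B \<psi>) b y)"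
      using tconv_bilinear[OF sp mA(1) mB(1) mA(1) mB(1) mA(4) mB(4)] by (simp_all add: tensor_smod_def)
    note s = bilinear_mapD(2,3)[OF s1]
    show ?thesis using sp X
    proof (induction X rule: tensor_induct)
      case t1: (tel a b)
      show ?case using sp Y
      proof (induction Y rule: tensor_induct)
        case (tel a' b')
        then show ?case
          using t1
          by (simp add: q m s2 gcls_closed[OF A \<phi>] gcls_closed[OF B \<psi>] sact_gns[OF A \<phi>] sact_gns[OF B \<psi>]
              star_algebraD(3)[OF A] star_algebraD(3)[OF B])
      qed (use t1 in \<open>simp add: q m s\<close>)
    qed (use Y in \<open>simp add: q m s\<close>)
  qed
  note ops = vadd_gns[OF tensor_phys, simplified] vscale_gns[OF tensor_phys, simplified]
    sform_gns[OF tensor_phys, simplified] sact_gns[OF tensor_phys, simplified]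
  have mul_closed: "amul (tensor_alg A B) X Y \<in> vcar ?T" if "X \<in> vcar ?T" "Y \<in> vcar ?T" for X Y
    using star_algebraD(3)[OF tensor_phys(1)] that by simp
  show "smod_hom (tensor_alg A B) (gns (tensor_alg A B) (tstate \<phi> \<psi>)) (tensor_alg A B) ?N
      (\<lambda>x. x) (gns_tensor A \<phi> B \<psi>)"
    unfolding smod_hom_def lin_map_def car
    by (auto simp: star_hom_id ops gns_tensor_gcls lin_mapD[OF qmap_linear] qmap_isometry act mul_closed)
  show "bij_betw (gns_tensor A \<phi> B \<psi>) (vcar (gns (tensor_alg A B) (tstate \<phi> \<psi>))) (vcar ?N)"
  proof (rule bij_betw_imageI)
    show "inj_on (gns_tensor A \<phi> B \<psi>) (vcar (gns (tensor_alg A B) (tstate \<phi> \<psi>)))"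
    proof (rule inj_onI, clarsimp simp: car gns_tensor_gcls)
      fix X Y assume X: "X \<in> vcar ?T" and Y: "Y \<in> vcar ?T" and "qmap X = qmap Y"
      then have *: "tstate \<phi> \<psi> (amul (tensor_alg A B) (astar (tensor_alg A B) Z) X) =
          tstate \<phi> \<psi> (amul (tensor_alg A B) (astar (tensor_alg A B) Z) Y)" if "Z \<in> vcar ?T" for Z
        using that qmap_isometry[of X Z] qmap_isometry[of Y Z] by simp
      have "tstate \<phi> \<psi> (amul (tensor_alg A B) Z X) = tstate \<phi> \<psi> (amul (tensor_alg A B) Z Y)"
        if "Z \<in> vcar ?T" for Z
        using *[of "astar (tensor_alg A B) Z"] star_algebraD(7,8)[OF tensor_phys(1), of Z] that by simp
      then show "?cl X = ?cl Y"
        using gcls_eq_iff[OF tensor_phys, of X Y] X Y by simp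
    qed
    have "Z \<in> qmap ` vcar ?T" if "Z \<in> vcar ?G" for Z
      using mA(1) mB(1) that
    proof (induction Z rule: tensor_induct)
      case (tel P Q)
      then obtain a b where ab: "a \<in> vcar A" "b \<in> vcar B" "P = gcls A \<phi> a" "Q = gcls B \<psi> b"
        by (auto simp: vcar_gns[OF A \<phi>] vcar_gns[OF B \<psi>])
      then show ?case by (intro image_eqI[of _ _ "tel A B a b"]) (simp_all add: qmap_tel)
    next
      case (add Z Z')
      then obtain X X' where "X \<in> vcar ?T" "X' \<in> vcar ?T" "Z = qmap X" "Z' = qmap X'" by blast
      then show ?case by (intro image_eqI[of _ _ "vadd ?T X X'"]) (simp_all add: lin_mapD(2)[OF qmap_linear])
    qed
    then show "gns_tensor A \<phi> B \<psi> ` vcar (gns (tensor_alg A B) (tstate \<phi> \<psi>)) = vcar ?N"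
      using lin_mapD(1)[OF qmap_linear] by (auto simp: car image_image gns_tensor_gcls)
  qed
qed

lemma gns_tensor_linear:
  "lin_map (gns (tensor_alg A B) (tstate \<phi> \<psi>)) (vtensor (gns A \<phi>) (gns B \<psi>)) (gns_tensor A \<phi> B \<psi>)"
  using smod_iso_gns_tensor by (simp add: smod_iso_def smod_hom_def)

text \<open>\<open>gns_map\<close> yields a class together with an explicit member
  \<open>F (repr W)\<close>, so the choice made by \<open>gns_tensor\<close> disappears. Coherence
  equations thereby become equations between maps evaluated at \<open>repr W\<close>.\<close>

lemma gns_tensor_gns_map:
  assumes "lin_map V (vtensor A B) F" "repr W \<in> vcar V"
  shows "gns_tensor A \<phi> B \<psi> (gns_map (tensor_alg A B) (tstate \<phi> \<psi>) F W) = qmap (F (repr W))"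
  using lin_mapD(1)[OF assms] by (simp add: gns_map_def gns_tensor_gcls)

end

section \<open>Naturality and coherence\<close>

lemma star_algebra_cplx: "star_algebra cplx"
  by (rule star_algebraI) (simp_all add: bilinear_map_def lin_map_def algebra_simps)

lemma rep_state_cplx: "rep_state cplx (\<lambda>z. z)"
  by (simp add: rep_state_def)

lemma star_module_cplx: "star_module cplx cplx_mod"
proof -
  have "cvs_space cplx_mod"
    using cvs_space_cplx unfolding cvs_space_def cplx_mod_def cplx_def by simp
  then show ?thesis
    unfolding star_module_def
    by (simp add: star_algebra_cplx) (auto simp: cplx_mod_def algebra_simps intro: spec[of _ 1])
qed

lemma smod_iso_gns_unit: "smod_iso cplx cplx_mod cplx (gns cplx (\<lambda>z. z)) (\<lambda>z. z) gns_unit"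
proof (rule smod_iso_if_bij[OF star_module_cplx])
  note c = star_algebra_cplx rep_state_cplx
  have eq: "gns_unit = gcls cplx (\<lambda>w. w)"
    by (simp add: fun_eq_iff gns_unit_def)
  have m: "vcar cplx_mod = UNIV" "vadd cplx_mod = (+)" "vscale cplx_mod = (*)" "sact cplx_mod = (*)"
    "sform cplx_mod = (\<lambda>z w. z * cnj w)"
    by (simp_all add: cplx_mod_def)
  show "smod_hom cplx cplx_mod cplx (gns cplx (\<lambda>z. z)) (\<lambda>z. z) gns_unit"
    by (simp add: smod_hom_def lin_map_def star_hom_id eq m gcls_closed[OF c] vadd_gns[OF c]
        vscale_gns[OF c] sform_gns[OF c] sact_gns[OF c])
  \<comment> \<open>Equality of classes, tested against \<open>1\<close>, is equality of numbers:
    the identity state has zero radical.\<close>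
  have "inj (gcls cplx (\<lambda>w. w))"
    by (rule injI) (simp add: gcls_eq_iff[OF c], metis mult_1)
  then show "bij_betw gns_unit (vcar cplx_mod) (vcar (gns cplx (\<lambda>z. z)))"
    by (simp add: bij_betw_def eq m vcar_gns[OF c])
qed

lemma gns_tensor_natural:
  assumes A: "star_algebra A" and \<phi>: "rep_state A \<phi>" and B: "star_algebra B" and \<psi>: "rep_state B \<psi>"
    and C: "star_algebra C" and \<chi>: "rep_state C \<chi>" and D: "star_algebra D" and \<omega>: "rep_state D \<omega>"
    and f: "phys_hom A \<phi> B \<psi> f" and g: "phys_hom C \<chi> D \<omega> g"
    and W: "W \<in> vcar (gns (tensor_alg B D) (tstate \<psi> \<omega>))"
  shows "gns_tensor A \<phi> C \<chi> (gns_map (tensor_alg A C) (tstate \<phi> \<chi>) (tmap A C f g) W)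
    = tmap (gns A \<phi>) (gns C \<chi>) (gns_map A \<phi> f) (gns_map C \<chi> g) (gns_tensor B \<psi> D \<omega> W)"
proof -
  note sp = A[THEN star_algebraD(1)] B[THEN star_algebraD(1)] C[THEN star_algebraD(1)] D[THEN star_algebraD(1)]
  have lin: "lin_map B A f" "lin_map D C g"
    using f g by (simp_all add: phys_hom_def star_hom_def)
  have glin: "lin_map (gns B \<psi>) (gns A \<phi>) (gns_map A \<phi> f)" "lin_map (gns D \<omega>) (gns C \<chi>) (gns_map C \<chi> g)"
    using smod_hom_gns_map[OF A \<phi> B \<psi> f] smod_hom_gns_map[OF C \<chi> D \<omega> g] by (simp_all add: smod_hom_def)
  have W': "repr W \<in> vcar (vtensor B D)"
    using gns_carrierD(1)[OF tensor_phys[OF B \<psi> D \<omega>] W] by simp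
  note t = tmap_linear[OF sp(2,4,1,3) lin]
  note gt = tmap_linear[OF cvs_space_gns[OF B \<psi>] cvs_space_gns[OF D \<omega>] cvs_space_gns[OF A \<phi>] cvs_space_gns[OF C \<chi>] glin]
  note q = qmap_linear[OF A \<phi> C \<chi>] qmap_linear[OF B \<psi> D \<omega>]
  have "tmap (gns A \<phi>) (gns C \<chi>) (gcls A \<phi>) (gcls C \<chi>) (tmap A C f g X) =
      tmap (gns A \<phi>) (gns C \<chi>) (gns_map A \<phi> f) (gns_map C \<chi> g)
        (tmap (gns B \<psi>) (gns D \<omega>) (gcls B \<psi>) (gcls D \<omega>) X)" if "X \<in> vcar (vtensor B D)" for X
    using sp(2,4) that
  proof (induction X rule: tensor_induct)
    case (tel b d)
    then show ?case
      by (simp add: t(2) gt(2) qmap_tel[OF A \<phi> C \<chi>] qmap_tel[OF B \<psi> D \<omega>] lin_mapD(1)[OF lin(1)]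
          lin_mapD(1)[OF lin(2)] gcls_closed[OF B \<psi>] gcls_closed[OF D \<omega>]
          gns_map_gcls[OF A \<phi> B \<psi> f] gns_map_gcls[OF C \<chi> D \<omega> g])
  qed (simp add: lin_mapD[OF t(1)] lin_mapD[OF gt(1)] lin_mapD[OF q(1)] lin_mapD[OF q(2)])
  from this[OF W'] show ?thesis
    by (simp add: gns_tensor_gns_map[OF A \<phi> C \<chi> t(1) W'] gns_tensor_repr[OF B \<psi> D \<omega>])
qed

lemma gns_tensor_assoc:
  assumes A: "star_algebra A" and \<phi>: "rep_state A \<phi>" and B: "star_algebra B" and \<psi>: "rep_state B \<psi>"
    and C: "star_algebra C" and \<chi>: "rep_state C \<chi>"
    and W: "W \<in> vcar (gns (tensor_alg (tensor_alg A B) C) (tstate (tstate \<phi> \<psi>) \<chi>))"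
  shows "tmap (gns A \<phi>) (vtensor (gns B \<psi>) (gns C \<chi>)) (\<lambda>x. x) (gns_tensor B \<psi> C \<chi>)
      (gns_tensor A \<phi> (tensor_alg B C) (tstate \<psi> \<chi>)
        (gns_map (tensor_alg A (tensor_alg B C)) (tstate \<phi> (tstate \<psi> \<chi>)) (tassoc A B C) W))
    = tassoc (gns A \<phi>) (gns B \<psi>) (gns C \<chi>)
        (tmap (vtensor (gns A \<phi>) (gns B \<psi>)) (gns C \<chi>) (gns_tensor A \<phi> B \<psi>) (\<lambda>x. x)
          (gns_tensor (tensor_alg A B) (tstate \<phi> \<psi>) C \<chi> W))"
proof -
  note sp = A[THEN star_algebraD(1)] B[THEN star_algebraD(1)] C[THEN star_algebraD(1)]
  note gsp = cvs_space_gns[OF A \<phi>] cvs_space_gns[OF B \<psi>] cvs_space_gns[OF C \<chi>]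
  note AB = tensor_phys[OF A \<phi> B \<psi>] and BC = tensor_phys[OF B \<psi> C \<chi>]
  note q1 = qmap_linear[OF A \<phi> BC] qmap_tel[OF A \<phi> BC]
  note q2 = qmap_linear[OF AB C \<chi>] qmap_tel[OF AB C \<chi>]
  have idA: "lin_map (gns A \<phi>) (gns A \<phi>) (\<lambda>x. x)" and idC: "lin_map (gns C \<chi>) (gns C \<chi>) (\<lambda>x. x)"
    by (simp_all add: lin_map_def)
  note t1 = tmap_linear[OF gsp(1) cvs_space_gns[OF BC] gsp(1) cvs_space_vtensor idA gns_tensor_linear[OF B \<psi> C \<chi>]]
  note t2 = tmap_linear[OF cvs_space_gns[OF AB] gsp(3) cvs_space_vtensor gsp(3) gns_tensor_linear[OF A \<phi> B \<psi>] idC]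
  note a1 = tassoc_linear[OF sp] and a2 = tassoc_linear[OF gsp]
  note cl = gcls_closed[OF A \<phi>] gcls_closed[OF B \<psi>] gcls_closed[OF C \<chi>]
    gcls_closed[OF AB, simplified] gcls_closed[OF BC, simplified]
  \<comment> \<open>\<open>F\<close> and \<open>G\<close> are the two paths around the square,
    lifted from classes to the algebra tensor product: \<open>F\<close> reassociates before passing
    to GNS classes, \<open>G\<close> after.\<close>
  define F where "F X = tmap (gns A \<phi>) (vtensor (gns B \<psi>) (gns C \<chi>)) (\<lambda>x. x) (gns_tensor B \<psi> C \<chi>)
      (tmap (gns A \<phi>) (gns (tensor_alg B C) (tstate \<psi> \<chi>)) (gcls A \<phi>) (gcls (tensor_alg B C) (tstate \<psi> \<chi>))
        (tassoc A B C X))" for X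
  define G where "G X = tassoc (gns A \<phi>) (gns B \<psi>) (gns C \<chi>)
        (tmap (vtensor (gns A \<phi>) (gns B \<psi>)) (gns C \<chi>) (gns_tensor A \<phi> B \<psi>) (\<lambda>x. x)
          (tmap (gns (tensor_alg A B) (tstate \<phi> \<psi>)) (gns C \<chi>) (gcls (tensor_alg A B) (tstate \<phi> \<psi>)) (gcls C \<chi>) X))" for X
  have F: "lin_map (vtensor (vtensor A B) C) (vtensor (gns A \<phi>) (vtensor (gns B \<psi>) (gns C \<chi>))) F"
    unfolding F_def by (intro lin_map_comp[OF lin_map_comp[OF a1(1) q1(1)[simplified]] t1(1)])
  have G: "lin_map (vtensor (vtensor A B) C) (vtensor (gns A \<phi>) (vtensor (gns B \<psi>) (gns C \<chi>))) G"
    unfolding G_def by (intro lin_map_comp[OF lin_map_comp[OF q2(1)[simplified] t2(1)] a2(1)])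
  \<comment> \<open>The triple product is generated by tensors whose left component is itself
    elementary, hence two nested inductions: here over the left component with \<open>c\<close>
    fixed, then over the outer tensor.\<close>
  have FG_tel: "F (tel (vtensor A B) C X c) = G (tel (vtensor A B) C X c)"
    if "X \<in> vcar (vtensor A B)" and c: "c \<in> vcar C" for X c
    using sp(1,2) that(1)
  proof (induction X rule: tensor_induct)
    case (tel a b)
    have "F (tel (vtensor A B) C (tel A B a b) c) = tel (gns A \<phi>) (vtensor (gns B \<psi>) (gns C \<chi>)) (gcls A \<phi> a)
        (tel (gns B \<psi>) (gns C \<chi>) (gcls B \<psi> b) (gcls C \<chi> c))"
      using tel c q1(2)[of a "tel B C b c"]
      by (simp add: F_def a1(2) t1(2) cl gns_tensor_gcls[OF B \<psi> C \<chi>] qmap_tel[OF B \<psi> C \<chi>])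
    moreover have "G (tel (vtensor A B) C (tel A B a b) c) = tel (gns A \<phi>) (vtensor (gns B \<psi>) (gns C \<chi>)) (gcls A \<phi> a)
        (tel (gns B \<psi>) (gns C \<chi>) (gcls B \<psi> b) (gcls C \<chi> c))"
      using tel c q2(2)[of "tel A B a b" c]
      by (simp add: G_def a2(2) t2(2) cl gns_tensor_gcls[OF A \<phi> B \<psi>] qmap_tel[OF A \<phi> B \<psi>])
    ultimately show ?case by simp
  next
    case (add X Y)
    then show ?case
      using c by (simp add: tel_linear(1)[OF cvs_space_vtensor sp(3)] lin_mapD(2)[OF F] lin_mapD(2)[OF G])
  qed
  have FG: "F X = G X" if "X \<in> vcar (vtensor (vtensor A B) C)" for X
    using cvs_space_vtensor sp(3) that
    by (induction X rule: tensor_induct) (simp_all add: FG_tel lin_mapD(2)[OF F] lin_mapD(2)[OF G])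
  have W': "repr W \<in> vcar (vtensor (vtensor A B) C)"
    using gns_carrierD(1)[OF tensor_phys[OF AB C \<chi>] W] by simp
  from FG[OF W'] show ?thesis
    unfolding F_def G_def gns_tensor_repr[OF AB C \<chi>]
    by (subst gns_tensor_gns_map[OF A \<phi> BC, of "vtensor (vtensor A B) C"]) (simp_all add: a1(1) W')
qed

text \<open>The unitor is taken in the direction \<open>v \<mapsto> 1 \<otimes> v\<close>. Its
  values are elementary tensors, so both sides are computed directly, without induction.\<close>

lemma gns_tensor_lunit:
  assumes A: "star_algebra A" and \<phi>: "rep_state A \<phi>" and P: "P \<in> vcar (gns A \<phi>)"
  shows "gns_tensor cplx (\<lambda>z. z) A \<phi> (gns_map (tensor_alg cplx A) (tstate (\<lambda>z. z) \<phi>) (lunit_inv A) P)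
    = tmap (gns cplx (\<lambda>z. z)) (gns A \<phi>) gns_unit (\<lambda>x. x) (lunit_inv (gns A \<phi>) P)"
proof -
  note c = star_algebra_cplx rep_state_cplx
  have u: "lin_map cplx (gns cplx (\<lambda>z. z)) gns_unit"
    unfolding gns_unit_def[abs_def] by (rule gcls_linear[OF c])
  have id: "lin_map (gns A \<phi>) (gns A \<phi>) (\<lambda>x. x)" by (simp add: lin_map_def)
  have "tmap (gns cplx (\<lambda>z. z)) (gns A \<phi>) gns_unit (\<lambda>x. x) (lunit_inv (gns A \<phi>) P)
      = tel (gns cplx (\<lambda>z. z)) (gns A \<phi>) (gns_unit 1) P"
    unfolding lunit_inv_def
    using tmap_linear(2)[OF cvs_space_cplx cvs_space_gns[OF A \<phi>] cvs_space_gns[OF c] cvs_space_gns[OF A \<phi>] u id, of 1 P] P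
    by simp
  moreover note gns_carrierD[OF A \<phi> P]
  ultimately show ?thesis
    by (simp add: gns_map_def lunit_inv_def gns_tensor_gcls[OF c A \<phi>] qmap_tel[OF c A \<phi>] gns_unit_def)
qed

lemma gns_tensor_runit:
  assumes A: "star_algebra A" and \<phi>: "rep_state A \<phi>" and P: "P \<in> vcar (gns A \<phi>)"
  shows "gns_tensor A \<phi> cplx (\<lambda>z. z) (gns_map (tensor_alg A cplx) (tstate \<phi> (\<lambda>z. z)) (runit_inv A) P)
    = tmap (gns A \<phi>) (gns cplx (\<lambda>z. z)) (\<lambda>x. x) gns_unit (runit_inv (gns A \<phi>) P)"
proof -
  note c = star_algebra_cplx rep_state_cplx
  have u: "lin_map cplx (gns cplx (\<lambda>z. z)) gns_unit"
    unfolding gns_unit_def[abs_def] by (rule gcls_linear[OF c])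
  have id: "lin_map (gns A \<phi>) (gns A \<phi>) (\<lambda>x. x)" by (simp add: lin_map_def)
  have "tmap (gns A \<phi>) (gns cplx (\<lambda>z. z)) (\<lambda>x. x) gns_unit (runit_inv (gns A \<phi>) P)
      = tel (gns A \<phi>) (gns cplx (\<lambda>z. z)) P (gns_unit 1)"
    unfolding runit_inv_def
    using tmap_linear(2)[OF cvs_space_gns[OF A \<phi>] cvs_space_cplx cvs_space_gns[OF A \<phi>] cvs_space_gns[OF c] id u, of P 1] P
    by simp
  moreover note gns_carrierD[OF A \<phi> P]
  ultimately show ?thesis
    by (simp add: gns_map_def runit_inv_def gns_tensor_gcls[OF A \<phi> c] qmap_tel[OF A \<phi> c] gns_unit_def)
qed

lemma gns_tensor_swap:
  assumes A: "star_algebra A" and \<phi>: "rep_state A \<phi>" and B: "star_algebra B" and \<psi>: "rep_state B \<psi>"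
    and W: "W \<in> vcar (gns (tensor_alg A B) (tstate \<phi> \<psi>))"
  shows "gns_tensor B \<psi> A \<phi> (gns_map (tensor_alg B A) (tstate \<psi> \<phi>) (tswap B A) W)
    = tswap (gns B \<psi>) (gns A \<phi>) (gns_tensor A \<phi> B \<psi> W)"
proof -
  note sp = A[THEN star_algebraD(1)] B[THEN star_algebraD(1)]
  note s = tswap_linear[OF sp] and gs = tswap_linear[OF cvs_space_gns[OF A \<phi>] cvs_space_gns[OF B \<psi>]]
  note q = qmap_linear[OF B \<psi> A \<phi>] qmap_linear[OF A \<phi> B \<psi>]
  have "tmap (gns B \<psi>) (gns A \<phi>) (gcls B \<psi>) (gcls A \<phi>) (tswap B A X) =
      tswap (gns B \<psi>) (gns A \<phi>) (tmap (gns A \<phi>) (gns B \<psi>) (gcls A \<phi>) (gcls B \<psi>) X)"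
    if "X \<in> vcar (vtensor A B)" for X
    using sp that
  proof (induction X rule: tensor_induct)
    case (tel a b)
    then show ?case
      by (simp add: s(2) gs(2) qmap_tel[OF B \<psi> A \<phi>] qmap_tel[OF A \<phi> B \<psi>] gcls_closed[OF A \<phi>] gcls_closed[OF B \<psi>])
  qed (simp add: lin_mapD[OF s(1)] lin_mapD[OF gs(1)] lin_mapD[OF q(1)] lin_mapD[OF q(2)])
  moreover have W': "repr W \<in> vcar (vtensor A B)"
    using gns_carrierD(1)[OF tensor_phys[OF A \<phi> B \<psi>] W] by simp
  ultimately show ?thesis
    by (simp add: gns_tensor_gns_map[OF B \<psi> A \<phi> s(1) W'] gns_tensor_repr[OF A \<phi> B \<psi>])
qed

section \<open>Functoriality\<close>

lemma gns_map_id: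
  assumes "star_algebra A" "rep_state A \<phi>" "P \<in> vcar (gns A \<phi>)"
  shows "gns_map A \<phi> (\<lambda>x. x) P = P"
  using gns_carrierD(2)[OF assms] by (simp add: gns_map_def)

text \<open>The inner value is a class with the explicit member \<open>g (repr P)\<close>, so
  \<open>gns_map_gcls\<close> for \<open>f\<close> removes the intermediate choice.\<close>

lemma gns_map_comp:
  assumes A: "star_algebra A" "rep_state A \<phi>" and B: "star_algebra B" "rep_state B \<psi>"
    and C: "star_algebra C" "rep_state C \<chi>"
    and f: "phys_hom A \<phi> B \<psi> f" and g: "phys_hom B \<psi> C \<chi> g" and P: "P \<in> vcar (gns C \<chi>)"
  shows "gns_map A \<phi> (f \<circ> g) P = gns_map A \<phi> f (gns_map B \<psi> g P)"
proof -
  have "lin_map C B g" using g by (simp add: phys_hom_def star_hom_def)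
  then have "g (repr P) \<in> vcar B" using gns_carrierD(1)[OF C P] by (rule lin_mapD(1))
  then have "gns_map A \<phi> f (gcls B \<psi> (g (repr P))) = gcls A \<phi> (f (g (repr P)))"
    by (rule gns_map_gcls[OF A B f])
  then show ?thesis by (simp add: gns_map_def)
qed

theorem mainTheorem8:
  shows
  \<comment> \<open>(1) on objects: GNS(phi) is a well-defined *-module over A (induced operations, form, action)\<close>
  "(\<forall>(A :: 'a salg) \<phi>. star_algebra A \<and> rep_state A \<phi> \<longrightarrow>
      star_module A (gns A \<phi>) \<and>
      (\<forall>a\<in>vcar A. \<forall>b\<in>vcar A.
         vadd (gns A \<phi>) (gcls A \<phi> a) (gcls A \<phi> b) = gcls A \<phi> (vadd A a b) \<and>
         sform (gns A \<phi>) (gcls A \<phi> a) (gcls A \<phi> b) = \<phi> (amul A (astar A b) a) \<and>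
         sact (gns A \<phi>) a (gcls A \<phi> b) = gcls A \<phi> (amul A a b)) \<and>
      (\<forall>c. \<forall>a\<in>vcar A. vscale (gns A \<phi>) c (gcls A \<phi> a) = gcls A \<phi> (vscale A c a)))
   \<and>
  \<comment> \<open>(2) on morphisms: GNS(f) is well defined, [x] |-> [f x], and (f, GNS f) is a *Mod morphism\<close>
   (\<forall>(A :: 'b salg) \<phi> (B :: 'c salg) \<psi> f.
      star_algebra A \<and> rep_state A \<phi> \<and> star_algebra B \<and> rep_state B \<psi> \<and> phys_hom A \<phi> B \<psi> f \<longrightarrow>
      (\<forall>x\<in>vcar B. gns_map A \<phi> f (gcls B \<psi> x) = gcls A \<phi> (f x)) \<and>
      smod_hom B (gns B \<psi>) A (gns A \<phi>) f (gns_map A \<phi> f))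
   \<and>
  \<comment> \<open>(3) functoriality: identities\<close>
   (\<forall>(A :: 'd salg) \<phi>. star_algebra A \<and> rep_state A \<phi> \<longrightarrow>
      (\<forall>P\<in>vcar (gns A \<phi>). gns_map A \<phi> (\<lambda>x. x) P = P))
   \<and>
  \<comment> \<open>(4) functoriality: composition (contravariant in the Phys direction)\<close>
   (\<forall>(A :: 'e salg) \<phi> (B :: 'f salg) \<psi> (C :: 'g salg) \<chi> f g.
      star_algebra A \<and> rep_state A \<phi> \<and> star_algebra B \<and> rep_state B \<psi> \<and>
      star_algebra C \<and> rep_state C \<chi> \<and> phys_hom A \<phi> B \<psi> f \<and> phys_hom B \<psi> C \<chi> g \<longrightarrow>
      (\<forall>P\<in>vcar (gns C \<chi>). gns_map A \<phi> (f \<circ> g) P = gns_map A \<phi> f (gns_map B \<psi> g P)))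
   \<and>
  \<comment> \<open>(5) tensor comparison: GNS(phi (x) psi) = GNS(phi) (x) GNS(psi) via [a (x) b] |-> [a] (x) [b],
      an isomorphism of *Mod lying over the identity of A (x) B\<close>
   (\<forall>(A :: 'h salg) \<phi> (B :: 'i salg) \<psi>.
      star_algebra A \<and> rep_state A \<phi> \<and> star_algebra B \<and> rep_state B \<psi> \<longrightarrow>
      (\<forall>a\<in>vcar A. \<forall>b\<in>vcar B.
         gns_tensor A \<phi> B \<psi> (gcls (tensor_alg A B) (tstate \<phi> \<psi>) (tel A B a b))
           = tel (gns A \<phi>) (gns B \<psi>) (gcls A \<phi> a) (gcls B \<psi> b)) \<and>
      smod_iso (tensor_alg A B) (gns (tensor_alg A B) (tstate \<phi> \<psi>))
               (tensor_alg A B) (tensor_smod (gns A \<phi>) (gns B \<psi>))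
               (\<lambda>x. x) (gns_tensor A \<phi> B \<psi>))
   \<and>
  \<comment> \<open>(6) unit comparison: (C, C) = (C, GNS(id)), an isomorphism of *Mod over the identity\<close>
   smod_iso cplx cplx_mod cplx (gns cplx (\<lambda>z. z)) (\<lambda>z. z) gns_unit
   \<and>
  \<comment> \<open>(7) naturality of the tensor comparison\<close>
   (\<forall>(A :: 'j salg) \<phi> (B :: 'k salg) \<psi> (C :: 'l salg) \<chi> (D :: 'm salg) \<omega> f g.
      star_algebra A \<and> rep_state A \<phi> \<and> star_algebra B \<and> rep_state B \<psi> \<and>
      star_algebra C \<and> rep_state C \<chi> \<and> star_algebra D \<and> rep_state D \<omega> \<and>
      phys_hom A \<phi> B \<psi> f \<and> phys_hom C \<chi> D \<omega> g \<longrightarrow>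
      (\<forall>W\<in>vcar (gns (tensor_alg B D) (tstate \<psi> \<omega>)).
         gns_tensor A \<phi> C \<chi> (gns_map (tensor_alg A C) (tstate \<phi> \<chi>) (tmap A C f g) W)
           = tmap (gns A \<phi>) (gns C \<chi>) (gns_map A \<phi> f) (gns_map C \<chi> g) (gns_tensor B \<psi> D \<omega> W)))
   \<and>
  \<comment> \<open>(8) compatibility with the associators\<close>
   (\<forall>(A :: 'n salg) \<phi> (B :: 'o salg) \<psi> (C :: 'p salg) \<chi>.
      star_algebra A \<and> rep_state A \<phi> \<and> star_algebra B \<and> rep_state B \<psi> \<and>
      star_algebra C \<and> rep_state C \<chi> \<longrightarrow>
      (\<forall>W\<in>vcar (gns (tensor_alg (tensor_alg A B) C) (tstate (tstate \<phi> \<psi>) \<chi>)).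
         tmap (gns A \<phi>) (vtensor (gns B \<psi>) (gns C \<chi>)) (\<lambda>x. x) (gns_tensor B \<psi> C \<chi>)
           (gns_tensor A \<phi> (tensor_alg B C) (tstate \<psi> \<chi>)
              (gns_map (tensor_alg A (tensor_alg B C)) (tstate \<phi> (tstate \<psi> \<chi>)) (tassoc A B C) W))
         = tassoc (gns A \<phi>) (gns B \<psi>) (gns C \<chi>)
             (tmap (vtensor (gns A \<phi>) (gns B \<psi>)) (gns C \<chi>) (gns_tensor A \<phi> B \<psi>) (\<lambda>x. x)
               (gns_tensor (tensor_alg A B) (tstate \<phi> \<psi>) C \<chi> W))))
   \<and>
  \<comment> \<open>(9) compatibility with the left unitors\<close>
   (\<forall>(A :: 'q salg) \<phi>. star_algebra A \<and> rep_state A \<phi> \<longrightarrow>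
      (\<forall>P\<in>vcar (gns A \<phi>).
         gns_tensor cplx (\<lambda>z. z) A \<phi> (gns_map (tensor_alg cplx A) (tstate (\<lambda>z. z) \<phi>) (lunit_inv A) P)
           = tmap (gns cplx (\<lambda>z. z)) (gns A \<phi>) gns_unit (\<lambda>x. x) (lunit_inv (gns A \<phi>) P)))
   \<and>
  \<comment> \<open>(10) compatibility with the right unitors\<close>
   (\<forall>(A :: 'r salg) \<phi>. star_algebra A \<and> rep_state A \<phi> \<longrightarrow>
      (\<forall>P\<in>vcar (gns A \<phi>).
         gns_tensor A \<phi> cplx (\<lambda>z. z) (gns_map (tensor_alg A cplx) (tstate \<phi> (\<lambda>z. z)) (runit_inv A) P)
           = tmap (gns A \<phi>) (gns cplx (\<lambda>z. z)) (\<lambda>x. x) gns_unit (runit_inv (gns A \<phi>) P)))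
   \<and>
  \<comment> \<open>(11) compatibility with the symmetries\<close>
   (\<forall>(A :: 's salg) \<phi> (B :: 't salg) \<psi>.
      star_algebra A \<and> rep_state A \<phi> \<and> star_algebra B \<and> rep_state B \<psi> \<longrightarrow>
      (\<forall>W\<in>vcar (gns (tensor_alg A B) (tstate \<phi> \<psi>)).
         gns_tensor B \<psi> A \<phi> (gns_map (tensor_alg B A) (tstate \<psi> \<phi>) (tswap B A) W)
           = tswap (gns B \<psi>) (gns A \<phi>) (gns_tensor A \<phi> B \<psi> W)))"
  apply (intro conjI allI impI ballI; (elim conjE)?)
  subgoal by (rule star_module_gns)
  subgoal by (rule vadd_gns)
  subgoal by (rule sform_gns)
  subgoal by (rule sact_gns)
  subgoal by (rule vscale_gns)
  subgoal by (rule gns_map_gcls)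
  subgoal by (rule smod_hom_gns_map)
  subgoal by (rule gns_map_id)
  subgoal by (rule gns_map_comp)
  subgoal by (simp add: gns_tensor_gcls qmap_tel)
  subgoal by (rule smod_iso_gns_tensor)
  subgoal by (rule smod_iso_gns_unit)
  subgoal by (rule gns_tensor_natural)
  subgoal by (rule gns_tensor_assoc)
  subgoal by (rule gns_tensor_lunit)
  subgoal by (rule gns_tensor_runit)
  subgoal by (rule gns_tensor_swap)
  done

end
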